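(* Let $n\ge 1$ and let $\mu\in\mathbb{C}^n$ be generic. The solenoidal Witt algebra $\mathbf{W}(n)_\mu$ has a one-dimensional universal central extension. It is generated by the $2$-cocycle $C_\mu:\mathbf{W}(n)_\mu\times\mathbf{W}(n)_\mu\to\mathbb{C}c_\mu$ given on basis elements by $$C_\mu(e_{\mu\cdot\alpha},e_{\mu\cdot\beta})=\frac{(\mu\cdot\alpha)^3-\mu\cdot\alpha}{12}\,\delta_{\alpha,-\beta}\,c_\mu,\qquad \alpha,\beta\in\mathbb{Z}^n.$$ That is, the universal central extension is the Lie algebra $\mathbf{Vir}(n)_\mu:=\mathbf{W}(n)_\mu\oplus\mathbb{C}c_\mu$ with basis $\{e_{\mu\cdot\alpha}:\alpha\in\mathbb{Z}^n\}\cup\{c_\mu\}$ and Lie bracket determined by $$[e_{\mu\cdot\alpha},e_{\mu\cdot\beta}]=\mu\cdot(\beta-\alpha)\,e_{\mu\cdot(\alpha+\beta)}+\frac{(\mu\cdot\alpha)^3-\mu\cdot\alpha}{12}\,\delta_{\alpha,-\beta}\,c_\mu,\qquad [\mathbf{Vir}(n)_\mu,c_\mu]=0.$$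
   Context: Let $A_n=\mathbb{C}[t_1^{\pm1},\dots,t_n^{\pm1}]$. For $\mu=(\mu_1,\dots,\mu_n)\in\mathbb{C}^n$ and $\alpha\in\mathbb{Z}^n$ write $\mu\cdot\alpha=\sum_i\mu_i\alpha_i$ and $t^\alpha=t_1^{\alpha_1}\cdots t_n^{\alpha_n}$. The vector $\mu$ is generic if $\mu\cdot\alpha\ne0$ for all $\alpha\in\mathbb{Z}^n\setminus\{0\}$. Put $d_\mu=\sum_{i=1}^n\mu_i t_i\frac{\partial}{\partial t_i}$ and $\Gamma_\mu=\{\mu\cdot\alpha:\alpha\in\mathbb{Z}^n\}\subset\mathbb{C}$. The solenoidal Witt algebra is $\mathbf{W}(n)_\mu:=A_nd_\mu$, a complex Lie algebra under the commutator of vector fields. It has basis $e_{\mu\cdot\alpha}:=t^\alpha d_\mu$, $\alpha\in\mathbb{Z}^n$, with $[e_{\mu\cdot\alpha},e_{\mu\cdot\beta}]=\mu\cdot(\beta-\alpha)\,e_{\mu\cdot(\alpha+\beta)}$. (Since $\mu$ is generic, $\alpha\mapsto\mu\cdot\alpha$ is injective.) Here $c_\mu$ denotes a basis vector of a one-dimensional central space $\mathbb{C}c_\mu$. *)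

theory Defs
  imports
    "HOL-Analysis.Finite_Cartesian_Product"
    "HOL-Library.Function_Algebras"
    "HOL-Library.Poly_Mapping"
    "HOL-Library.Product_Plus"
begin

section \<open>Complex Lie algebras and central extensions\<close>

text \<open>A Lie algebra lives on a subspace (its carrier) of an ambient complex vector space, whose
  addition is the one of the type; maps between Lie algebras are only constrained on carriers.\<close>

record 'a cx_lie =
  lie_carrier :: "'a set"
  lie_scale :: "complex \<Rightarrow> 'a \<Rightarrow> 'a"
  lie_bracket :: "'a \<Rightarrow> 'a \<Rightarrow> 'a"

locale lie_algebra = vector_space "lie_scale L" for L :: "'a::ab_group_add cx_lie" +
  assumes subspace_carrier: "subspace (lie_carrier L)"
    and bracket_closed:
      "\<lbrakk>x \<in> lie_carrier L; y \<in> lie_carrier L\<rbrakk> \<Longrightarrow> lie_bracket L x y \<in> lie_carrier L"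
    and bracket_add_left:
      "\<lbrakk>x \<in> lie_carrier L; y \<in> lie_carrier L; z \<in> lie_carrier L\<rbrakk>
        \<Longrightarrow> lie_bracket L (x + y) z = lie_bracket L x z + lie_bracket L y z"
    and bracket_add_right:
      "\<lbrakk>x \<in> lie_carrier L; y \<in> lie_carrier L; z \<in> lie_carrier L\<rbrakk>
        \<Longrightarrow> lie_bracket L x (y + z) = lie_bracket L x y + lie_bracket L x z"
    and bracket_scale_left:
      "\<lbrakk>x \<in> lie_carrier L; y \<in> lie_carrier L\<rbrakk>
        \<Longrightarrow> lie_bracket L (lie_scale L c x) y = lie_scale L c (lie_bracket L x y)"
    and bracket_scale_right:
      "\<lbrakk>x \<in> lie_carrier L; y \<in> lie_carrier L\<rbrakk>
        \<Longrightarrow> lie_bracket L x (lie_scale L c y) = lie_scale L c (lie_bracket L x y)"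
    and bracket_self: "x \<in> lie_carrier L \<Longrightarrow> lie_bracket L x x = 0"
    and jacobi:
      "\<lbrakk>x \<in> lie_carrier L; y \<in> lie_carrier L; z \<in> lie_carrier L\<rbrakk>
        \<Longrightarrow> lie_bracket L x (lie_bracket L y z) + lie_bracket L y (lie_bracket L z x)
            + lie_bracket L z (lie_bracket L x y) = 0"

definition lie_linear ::
  "'a::ab_group_add cx_lie \<Rightarrow> (complex \<Rightarrow> 'b::ab_group_add \<Rightarrow> 'b) \<Rightarrow> ('a \<Rightarrow> 'b) \<Rightarrow> bool" where
  "lie_linear L s f \<longleftrightarrow>
     (\<forall>x\<in>lie_carrier L. \<forall>y\<in>lie_carrier L. f (x + y) = f x + f y) \<and>
     (\<forall>c. \<forall>x\<in>lie_carrier L. f (lie_scale L c x) = s c (f x))"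

definition lie_hom ::
  "'a::ab_group_add cx_lie \<Rightarrow> 'b::ab_group_add cx_lie \<Rightarrow> ('a \<Rightarrow> 'b) \<Rightarrow> bool" where
  "lie_hom L M f \<longleftrightarrow>
     f ` lie_carrier L \<subseteq> lie_carrier M \<and>
     lie_linear L (lie_scale M) f \<and>
     (\<forall>x\<in>lie_carrier L. \<forall>y\<in>lie_carrier L. f (lie_bracket L x y) = lie_bracket M (f x) (f y))"

definition lie_kernel ::
  "'a::ab_group_add cx_lie \<Rightarrow> ('a \<Rightarrow> 'b::ab_group_add) \<Rightarrow> 'a set" where
  "lie_kernel L f = {x \<in> lie_carrier L. f x = 0}"

definition lie_center :: "'a::ab_group_add cx_lie \<Rightarrow> 'a set" where
  "lie_center L = {z \<in> lie_carrier L. \<forall>x\<in>lie_carrier L. lie_bracket L x z = 0}"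

definition central_extension ::
  "'a::ab_group_add cx_lie \<Rightarrow> 'b::ab_group_add cx_lie \<Rightarrow> ('b \<Rightarrow> 'a) \<Rightarrow> bool" where
  "central_extension L E p \<longleftrightarrow>
     lie_algebra L \<and> lie_algebra E \<and> lie_hom E L p \<and>
     p ` lie_carrier E = lie_carrier L \<and> lie_kernel E p \<subseteq> lie_center E"

text \<open>HOL cannot quantify over types inside a formula, so the type carrying the competing central
  extensions is a parameter; a theorem in which it is a type variable covers all of them.\<close>

definition universal_central_extension ::
  "'e::ab_group_add itself \<Rightarrow> 'a::ab_group_add cx_lie \<Rightarrow> 'b::ab_group_add cx_lie
    \<Rightarrow> ('b \<Rightarrow> 'a) \<Rightarrow> bool" where
  "universal_central_extension T L E p \<longleftrightarrow>
     central_extension L E p \<and>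
     (\<forall>(F :: 'e cx_lie) q. central_extension L F q \<longrightarrow>
        (\<exists>f. lie_hom E F f \<and> (\<forall>x\<in>lie_carrier E. q (f x) = p x) \<and>
          (\<forall>g. lie_hom E F g \<and> (\<forall>x\<in>lie_carrier E. q (g x) = p x)
             \<longrightarrow> (\<forall>x\<in>lie_carrier E. g x = f x))))"

definition two_cocycle :: "'a::ab_group_add cx_lie \<Rightarrow> ('a \<Rightarrow> 'a \<Rightarrow> complex) \<Rightarrow> bool" where
  "two_cocycle L \<psi> \<longleftrightarrow>
     (\<forall>y\<in>lie_carrier L. lie_linear L (*) (\<lambda>x. \<psi> x y)) \<and>
     (\<forall>x\<in>lie_carrier L. lie_linear L (*) (\<psi> x)) \<and>
     (\<forall>x\<in>lie_carrier L. \<psi> x x = 0) \<and>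
     (\<forall>x\<in>lie_carrier L. \<forall>y\<in>lie_carrier L. \<forall>z\<in>lie_carrier L.
        \<psi> x (lie_bracket L y z) + \<psi> y (lie_bracket L z x) + \<psi> z (lie_bracket L x y) = 0)"

definition two_coboundary :: "'a::ab_group_add cx_lie \<Rightarrow> ('a \<Rightarrow> 'a \<Rightarrow> complex) \<Rightarrow> bool" where
  "two_coboundary L \<psi> \<longleftrightarrow>
     (\<exists>g. lie_linear L (*) g \<and>
        (\<forall>x\<in>lie_carrier L. \<forall>y\<in>lie_carrier L. \<psi> x y = g (lie_bracket L x y)))"

text \<open>The space \<open>L \<oplus> \<complex>c\<close>, with \<open>c = (0, 1)\<close> and bracket \<open>[x, y] + \<psi> x y c\<close> on \<open>L\<close>.\<close>

definition cocycle_extension ::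
  "'a::ab_group_add cx_lie \<Rightarrow> ('a \<Rightarrow> 'a \<Rightarrow> complex) \<Rightarrow> ('a \<times> complex) cx_lie" where
  "cocycle_extension L \<psi> =
     \<lparr>lie_carrier = lie_carrier L \<times> UNIV,
      lie_scale = (\<lambda>c u. (lie_scale L c (fst u), c * snd u)),
      lie_bracket = (\<lambda>u v. (lie_bracket L (fst u) (fst v), \<psi> (fst u) (fst v)))\<rparr>"


section \<open>The solenoidal Witt algebra\<close>

text \<open>Laurent polynomials in variables indexed by \<open>'n\<close>, as the group algebra of \<open>\<int>\<^sup>n\<close>:
  \<^term>\<open>Poly_Mapping.single\<close> \<open>\<alpha> c\<close> is \<open>c t\<^sup>\<alpha>\<close>, and multiplication is convolution.\<close>

type_synonym 'n laurent = "(int ^ 'n) \<Rightarrow>\<^sub>0 complex"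

definition dot :: "complex ^ 'n \<Rightarrow> int ^ 'n \<Rightarrow> complex" where
  "dot \<mu> \<alpha> = (\<Sum>i\<in>UNIV. \<mu> $ i * of_int (\<alpha> $ i))"

definition generic :: "complex ^ 'n::finite \<Rightarrow> bool" where
  "generic \<mu> \<longleftrightarrow> (\<forall>\<alpha>. \<alpha> \<noteq> 0 \<longrightarrow> dot \<mu> \<alpha> \<noteq> 0)"

definition laurent_monom :: "int ^ 'n \<Rightarrow> 'n::finite laurent" where
  "laurent_monom \<alpha> = Poly_Mapping.single \<alpha> 1"

definition laurent_scale :: "complex \<Rightarrow> 'n::finite laurent \<Rightarrow> 'n laurent" where
  "laurent_scale c f = Poly_Mapping.single 0 c * f"

definition laurent_partial :: "'n \<Rightarrow> 'n::finite laurent \<Rightarrow> 'n laurent" where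
  "laurent_partial i f =
     (\<Sum>\<alpha>\<in>Poly_Mapping.keys f.
        Poly_Mapping.single (\<alpha> - axis i 1) (of_int (\<alpha> $ i) * Poly_Mapping.lookup f \<alpha>))"

definition d_mu :: "complex ^ 'n \<Rightarrow> 'n::finite laurent \<Rightarrow> 'n laurent" where
  "d_mu \<mu> f =
     (\<Sum>i\<in>UNIV. laurent_scale (\<mu> $ i) (laurent_monom (axis i 1) * laurent_partial i f))"

definition vfield :: "complex ^ 'n \<Rightarrow> 'n::finite laurent \<Rightarrow> 'n laurent \<Rightarrow> 'n laurent" where
  "vfield \<mu> a = (\<lambda>f. a * d_mu \<mu> f)"

definition witt :: "complex ^ 'n \<Rightarrow> ('n::finite laurent \<Rightarrow> 'n laurent) cx_lie" where
  "witt \<mu> =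
     \<lparr>lie_carrier = range (vfield \<mu>),
      lie_scale = (\<lambda>c D f. laurent_scale c (D f)),
      lie_bracket = (\<lambda>D E f. D (E f) - E (D f))\<rparr>"

text \<open>The basis elements are indexed by \<open>\<alpha>\<close> rather than by \<open>\<mu> \<cdot> \<alpha>\<close>.\<close>

definition witt_e :: "complex ^ 'n \<Rightarrow> int ^ 'n \<Rightarrow> 'n::finite laurent \<Rightarrow> 'n laurent" where
  "witt_e \<mu> \<alpha> = vfield \<mu> (laurent_monom \<alpha>)"

text \<open>For generic \<open>\<mu>\<close> the map \<^term>\<open>vfield\<close> \<open>\<mu>\<close> is injective, so the coefficients of \<open>D\<close> in the
  basis \<^term>\<open>witt_e\<close> \<open>\<mu>\<close> are those of the Laurent polynomial \<open>a\<close> with \<open>D = a d\<^sub>\<mu>\<close>. The cocycle is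
  the bilinear extension of its values on this basis.\<close>

definition witt_coeff :: "complex ^ 'n \<Rightarrow> ('n::finite laurent \<Rightarrow> 'n laurent) \<Rightarrow> 'n laurent" where
  "witt_coeff \<mu> D = the_inv (vfield \<mu>) D"

definition C_mu ::
  "complex ^ 'n \<Rightarrow> ('n::finite laurent \<Rightarrow> 'n laurent) \<Rightarrow> ('n laurent \<Rightarrow> 'n laurent) \<Rightarrow> complex" where
  "C_mu \<mu> D E =
     (\<Sum>\<alpha>\<in>Poly_Mapping.keys (witt_coeff \<mu> D). \<Sum>\<beta>\<in>Poly_Mapping.keys (witt_coeff \<mu> E).
        Poly_Mapping.lookup (witt_coeff \<mu> D) \<alpha> * Poly_Mapping.lookup (witt_coeff \<mu> E) \<beta> *
        (if \<alpha> = - \<beta> then (dot \<mu> \<alpha> ^ 3 - dot \<mu> \<alpha>) / 12 else 0))"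

definition vir :: "complex ^ 'n \<Rightarrow> (('n::finite laurent \<Rightarrow> 'n laurent) \<times> complex) cx_lie" where
  "vir \<mu> = cocycle_extension (witt \<mu>) (C_mu \<mu>)"

definition vir_e ::
  "complex ^ 'n \<Rightarrow> int ^ 'n \<Rightarrow> ('n::finite laurent \<Rightarrow> 'n laurent) \<times> complex" where
  "vir_e \<mu> \<alpha> = (witt_e \<mu> \<alpha>, 0)"

definition vir_c :: "('n::finite laurent \<Rightarrow> 'n laurent) \<times> complex" where
  "vir_c = (0, 1)"

end

theory Submission
  imports Defs
begin

text \<open>
  Write \<open>e\<^sub>\<alpha>\<close> for the basis of the solenoidal Witt algebra and identify \<open>\<alpha>\<close> with its degree
  \<open>\<mu> \<cdot> \<alpha>\<close>; genericity says that this identification is injective. The heart of the matter is a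
  normal form for \<open>2\<close>-cocycles \<open>\<psi>\<close> with values in any vector space. The cocycle identity for
  \<open>e\<^sub>0, e\<^sub>\<beta>, e\<^sub>\<gamma>\<close> shows that \<open>\<psi>\<close> agrees with a coboundary whenever \<open>\<beta> + \<gamma> \<noteq> 0\<close>. What is left
  is a function \<open>\<phi> \<alpha> = \<psi>(e\<^sub>\<alpha>, e\<^sub>-\<^sub>\<alpha>)\<close> subject to
  \<open>(\<beta> - \<alpha>) \<phi>(\<alpha> + \<beta>) = (2\<alpha> + \<beta>) \<phi>(\<beta>) - (\<alpha> + 2\<beta>) \<phi>(\<alpha>)\<close>. The functions \<open>\<alpha>\<^sup>3\<close> and \<open>\<alpha>\<close> solve this
  equation, and a solution that vanishes at some \<open>\<epsilon> \<noteq> 0\<close> and at \<open>2\<epsilon>\<close> is zero on the whole group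
  (\<open>cubic_equation_unique\<close>), whatever its rank. So \<open>\<phi>\<close> is a combination of \<open>\<alpha>\<^sup>3\<close> and \<open>\<alpha>\<close>, and the
  second of these is a coboundary (\<open>graded_cocycle.normal_form\<close>).

  With complex coefficients, the normal form says that every cocycle is cohomologous to a multiple
  of \<open>C\<^sub>\<mu>\<close>. The cocycle \<open>C\<^sub>\<mu>\<close> is itself not a coboundary, because a cubic function is not linear.

  For universality, let a central extension with kernel \<open>K\<close> be given and lift the basis arbitrarily.
  The failure of the lifts to satisfy the bracket relations is a \<open>K\<close>-valued cocycle. Its normal form
  prescribes how to correct the lifts by elements of \<open>K\<close> and which element of \<open>K\<close> is to be the image
  of the central element \<open>c\<close> (\<open>witt_basis_lift\<close>). The resulting homomorphism is unique because the
  extended algebra is spanned by its brackets (\<open>lifts_unique\<close>, \<open>vir_perfect\<close>).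
\<close>


section \<open>Normal form of graded cocycles\<close>

text \<open>Values of a \<open>2\<close>-cocycle of the Witt algebra on basis elements indexed by a group, which
  \<open>deg\<close> embeds into the field. The coefficients form an arbitrary vector space: the scalar case
  yields the second cohomology, and the case of the kernel of a central extension yields
  universality.\<close>

locale graded_cocycle = vector_space scale
  for scale :: "'k::field_char_0 \<Rightarrow> 'v::ab_group_add \<Rightarrow> 'v" +
  fixes deg :: "'g::ab_group_add \<Rightarrow> 'k" and \<psi> :: "'g \<Rightarrow> 'g \<Rightarrow> 'v"
  assumes deg_add: "deg (\<alpha> + \<beta>) = deg \<alpha> + deg \<beta>"
    and deg_eq_0: "deg \<alpha> = 0 \<Longrightarrow> \<alpha> = 0"
    and antisym: "\<psi> \<alpha> \<beta> = - \<psi> \<beta> \<alpha>"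
    and cocycle: "scale (deg \<gamma> - deg \<beta>) (\<psi> \<alpha> (\<beta> + \<gamma>)) +
      scale (deg \<alpha> - deg \<gamma>) (\<psi> \<beta> (\<gamma> + \<alpha>)) +
      scale (deg \<beta> - deg \<alpha>) (\<psi> \<gamma> (\<alpha> + \<beta>)) = 0"
begin

lemma deg_0 [simp]: "deg 0 = 0"
  using deg_add[of 0 0] by simp

lemma deg_minus [simp]: "deg (- \<alpha>) = - deg \<alpha>"
  using deg_add[of \<alpha> "- \<alpha>"] by (simp add: eq_neg_iff_add_eq_0 add.commute)

text \<open>The degree-zero basis element acts on the others by their degree, so a cocycle identity
  containing it determines \<open>\<psi> \<beta> \<gamma>\<close> by a function of \<open>\<beta> + \<gamma>\<close> wherever that sum is nonzero.\<close>

lemma cocycle_at_0: "scale (deg \<gamma> - deg \<beta>) (\<psi> 0 (\<beta> + \<gamma>)) = scale (deg (\<beta> + \<gamma>)) (\<psi> \<beta> \<gamma>)"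
  using cocycle[of \<gamma> \<beta> 0] antisym[of \<gamma> \<beta>]
  by (simp add: deg_add algebra_simps)

lemma off_diagonal:
  assumes "\<beta> + \<gamma> \<noteq> 0"
  shows "\<psi> \<beta> \<gamma> = scale (deg \<gamma> - deg \<beta>) (scale (1 / deg (\<beta> + \<gamma>)) (\<psi> 0 (\<beta> + \<gamma>)))"
proof -
  have nz: "deg (\<beta> + \<gamma>) \<noteq> 0" using assms deg_eq_0 by blast
  have "scale (1 / deg (\<beta> + \<gamma>)) (scale (deg (\<beta> + \<gamma>)) (\<psi> \<beta> \<gamma>)) = \<psi> \<beta> \<gamma>"
    using nz by simp
  then show ?thesis
    unfolding cocycle_at_0[symmetric] by (simp add: mult.commute)
qed

text \<open>In the cocycle identity for three indices of sum zero, only the values \<open>\<psi> \<alpha> (- \<alpha>)\<close> left open by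
  the previous lemma occur.\<close>

lemma diagonal_equation:
  "scale (deg \<beta> - deg \<alpha>) (\<psi> (\<alpha> + \<beta>) (- (\<alpha> + \<beta>))) =
     scale (2 * deg \<alpha> + deg \<beta>) (\<psi> \<beta> (- \<beta>)) - scale (deg \<alpha> + 2 * deg \<beta>) (\<psi> \<alpha> (- \<alpha>))"
proof -
  have "scale (- deg (\<alpha> + \<beta>) - deg \<beta>) (\<psi> \<alpha> (- \<alpha>)) +
      scale (deg \<alpha> + deg (\<alpha> + \<beta>)) (\<psi> \<beta> (- \<beta>)) -
      scale (deg \<beta> - deg \<alpha>) (\<psi> (\<alpha> + \<beta>) (- (\<alpha> + \<beta>))) = 0"
    using cocycle[of "- (\<alpha> + \<beta>)" \<beta> \<alpha>] antisym[of "- (\<alpha> + \<beta>)" "\<alpha> + \<beta>"] deg_minus[of "\<alpha> + \<beta>"]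
    by simp
  then have "scale (deg \<beta> - deg \<alpha>) (\<psi> (\<alpha> + \<beta>) (- (\<alpha> + \<beta>))) =
      scale (deg \<alpha> + deg (\<alpha> + \<beta>)) (\<psi> \<beta> (- \<beta>)) - scale (deg (\<alpha> + \<beta>) + deg \<beta>) (\<psi> \<alpha> (- \<alpha>))"
    by (simp add: algebra_simps)
  also have "deg \<alpha> + deg (\<alpha> + \<beta>) = 2 * deg \<alpha> + deg \<beta>" by (simp add: deg_add)
  also have "deg (\<alpha> + \<beta>) + deg \<beta> = deg \<alpha> + 2 * deg \<beta>" by (simp add: deg_add)
  finally show ?thesis .
qed

end

text \<open>The equation lets one pass from \<open>\<beta>\<close> to \<open>\<beta> + 2\<epsilon>\<close> either in one step of \<open>2\<epsilon>\<close> or in two steps of \<open>\<epsilon>\<close>.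
  After clearing denominators the two resulting factors of \<open>\<phi> \<beta>\<close> differ by the constant
  \<open>12 (deg \<epsilon>)\<^sup>3\<close>, so \<open>\<phi>\<close> vanishes. The element \<open>\<beta>\<close> need not be a multiple of \<open>\<epsilon>\<close>,
  which is what makes the argument work in every rank.\<close>

lemma (in vector_space) cubic_equation_unique:
  fixes deg :: "'g::ab_group_add \<Rightarrow> 'a" and \<phi> :: "'g \<Rightarrow> 'b"
  assumes deg_add: "\<And>\<alpha> \<beta>. deg (\<alpha> + \<beta>) = deg \<alpha> + deg \<beta>"
    and eq: "\<And>\<alpha> \<beta>. scale (deg \<beta> - deg \<alpha>) (\<phi> (\<alpha> + \<beta>)) =
      scale (2 * deg \<alpha> + deg \<beta>) (\<phi> \<beta>) - scale (deg \<alpha> + 2 * deg \<beta>) (\<phi> \<alpha>)"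
    and "\<phi> \<epsilon> = 0" "\<phi> (\<epsilon> + \<epsilon>) = 0" "12 * deg \<epsilon> ^ 3 \<noteq> 0"
  shows "\<phi> \<beta> = 0"
proof -
  define p x where "p = deg \<epsilon>" and "x = deg \<beta>"
  have one: "scale (x - p) (\<phi> (\<epsilon> + \<beta>)) = scale (2 * p + x) (\<phi> \<beta>)"
    using eq[of \<beta> \<epsilon>] assms(3) by (simp add: p_def x_def)
  have two: "scale x (\<phi> (\<epsilon> + \<epsilon> + \<beta>)) = scale (3 * p + x) (\<phi> (\<epsilon> + \<beta>))"
    using eq[of "\<epsilon> + \<beta>" \<epsilon>] assms(3) by (simp add: p_def x_def deg_add add.assoc)
  have jump: "scale (x - 2 * p) (\<phi> (\<epsilon> + \<epsilon> + \<beta>)) = scale (4 * p + x) (\<phi> \<beta>)"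
    using eq[of \<beta> "\<epsilon> + \<epsilon>"] assms(4) by (simp add: p_def x_def deg_add algebra_simps flip: mult_2)
  have "scale ((x - 2 * p) * (x - p) * x) (\<phi> (\<epsilon> + \<epsilon> + \<beta>)) =
      scale ((x - 2 * p) * (3 * p + x) * (2 * p + x)) (\<phi> \<beta>)"
    using arg_cong[OF two, of "scale ((x - 2 * p) * (x - p))"]
      arg_cong[OF one, of "scale ((x - 2 * p) * (3 * p + x))"]
    by (simp add: mult_ac)
  moreover have "scale ((x - 2 * p) * (x - p) * x) (\<phi> (\<epsilon> + \<epsilon> + \<beta>)) =
      scale ((x - p) * x * (4 * p + x)) (\<phi> \<beta>)"
    using arg_cong[OF jump, of "scale ((x - p) * x)"] by (simp add: mult_ac)
  ultimately have "scale ((x - p) * x * (4 * p + x) - (x - 2 * p) * (3 * p + x) * (2 * p + x)) (\<phi> \<beta>) = 0"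
    by (simp add: scale_left_diff_distrib)
  also have "(x - p) * x * (4 * p + x) - (x - 2 * p) * (3 * p + x) * (2 * p + x) = 12 * p ^ 3"
    by algebra
  finally show ?thesis using assms(5) by (simp add: p_def)
qed

context graded_cocycle begin

text \<open>The functions \<open>deg\<^sup>3\<close> and \<open>deg\<close> solve the equation of the diagonal values. Their coefficients can
  be chosen to match the values at \<open>\<epsilon>\<close> and \<open>2\<epsilon>\<close>, and a solution that vanishes at both is zero.\<close>

lemma diagonal_cubic:
  assumes K: "subspace K" "\<And>\<alpha>. \<psi> \<alpha> (- \<alpha>) \<in> K" and "(\<epsilon> :: 'g) \<noteq> 0"
  obtains a b where "a \<in> K" "b \<in> K" "\<And>\<alpha>. \<psi> \<alpha> (- \<alpha>) = scale (deg \<alpha> ^ 3) a + scale (deg \<alpha>) b"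
proof -
  define p where "p = deg \<epsilon>"
  have p: "p \<noteq> 0" using assms deg_eq_0 by (auto simp: p_def)
  define u v where "u = \<psi> \<epsilon> (- \<epsilon>)" and "v = \<psi> (\<epsilon> + \<epsilon>) (- (\<epsilon> + \<epsilon>))"
  \<comment> \<open>Solutions of \<open>p\<^sup>3 a + p b = u\<close> and \<open>8 p\<^sup>3 a + 2 p b = v\<close>.\<close>
  define a where "a = scale (1 / (6 * p ^ 3)) (v - scale 2 u)"
  define b where "b = scale (1 / (6 * p)) (scale 8 u - v)"
  define \<phi> where "\<phi> \<alpha> = \<psi> \<alpha> (- \<alpha>) - (scale (deg \<alpha> ^ 3) a + scale (deg \<alpha>) b)" for \<alpha>
  have eq: "scale (deg \<beta> - deg \<alpha>) (\<phi> (\<alpha> + \<beta>)) =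
      scale (2 * deg \<alpha> + deg \<beta>) (\<phi> \<beta>) - scale (deg \<alpha> + 2 * deg \<beta>) (\<phi> \<alpha>)" for \<alpha> \<beta>
  proof -
    let ?x = "deg \<alpha>" and ?y = "deg \<beta>"
    have "(?y - ?x) * (?x + ?y) ^ 3 = (2 * ?x + ?y) * ?y ^ 3 - (?x + 2 * ?y) * ?x ^ 3"
      "(?y - ?x) * (?x + ?y) = (2 * ?x + ?y) * ?y - (?x + 2 * ?y) * ?x"
      by algebra+
    then show ?thesis
      unfolding \<phi>_def scale_right_diff_distrib diagonal_equation
      by (simp add: deg_add scale_right_distrib scale_left_diff_distrib)
  qed
  have sc: "p ^ 3 * (1 / (6 * p ^ 3)) = 1 / 6" "p * (1 / (6 * p)) = 1 / 6"
     "(p + p) ^ 3 * (1 / (6 * p ^ 3)) = 4 / 3" "(p + p) * (1 / (6 * p)) = 1 / 3"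
    using p by (simp_all add: power3_eq_cube field_simps)
  have "scale (p ^ 3) a + scale p b = u"
  proof -
    have "scale (p ^ 3) a + scale p b = scale (1/6) v - scale (1/6 * 2) u + (scale (1/6*8) u - scale (1/6) v)"
      by (simp only: a_def b_def scale_scale sc) (simp only: scale_right_diff_distrib scale_scale)
    also have "\<dots> = scale (1/6*8 - 1/6*2) u" unfolding scale_left_diff_distrib by simp
    finally show ?thesis by simp
  qed
  moreover have "scale ((p + p) ^ 3) a + scale (p + p) b = v"
  proof -
    have "scale ((p + p) ^ 3) a + scale (p + p) b = scale (4/3) v - scale (4/3 * 2) u + (scale (1/3*8) u - scale (1/3) v)"
      by (simp only: a_def b_def scale_scale sc) (simp only: scale_right_diff_distrib scale_scale)
    also have "\<dots> = scale (4/3 - 1/3) v" unfolding scale_left_diff_distrib by simp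
    finally show ?thesis by simp
  qed
  ultimately have zero: "\<phi> \<epsilon> = 0" "\<phi> (\<epsilon> + \<epsilon>) = 0"
    by (simp_all add: \<phi>_def u_def v_def p_def deg_add)
  have "12 * deg \<epsilon> ^ 3 \<noteq> 0" using p by (simp add: p_def)
  from cubic_equation_unique[of deg \<phi>, OF deg_add eq zero this] have "\<phi> \<alpha> = 0" for \<alpha> .
  then have "\<psi> \<alpha> (- \<alpha>) = scale (deg \<alpha> ^ 3) a + scale (deg \<alpha>) b" for \<alpha> by (simp add: \<phi>_def)
  moreover have "u \<in> K" "v \<in> K" unfolding u_def v_def by (rule K)+
  then have "a \<in> K" "b \<in> K"
    unfolding a_def b_def using K(1) by (auto intro!: subspace_scale subspace_diff)
  ultimately show ?thesis using that by blast
qed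

text \<open>The function \<open>g\<close> is the primitive of the coboundary part. The linear part of the diagonal
  values is the coboundary of a function supported at \<open>0\<close>, because \<open>[e\<^sub>\<alpha>, e\<^sub>-\<^sub>\<alpha>]\<close> has coefficient
  \<open>- 2 deg \<alpha>\<close>; one may therefore replace the cubic \<open>deg\<^sup>3\<close> by \<open>deg\<^sup>3 - deg\<close>.\<close>

lemma normal_form:
  assumes K: "subspace K" "\<And>\<alpha> \<beta>. \<psi> \<alpha> \<beta> \<in> K" and "(\<epsilon> :: 'g) \<noteq> 0"
  shows "\<exists>g k. k \<in> K \<and> (\<forall>\<alpha>. g \<alpha> \<in> K) \<and>
    (\<forall>\<alpha> \<beta>. \<psi> \<alpha> \<beta> = scale (deg \<beta> - deg \<alpha>) (g (\<alpha> + \<beta>)) +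
      scale (if \<alpha> = - \<beta> then (deg \<alpha> ^ 3 - deg \<alpha>) / 12 else 0) k)"
proof -
  obtain a b where ab: "a \<in> K" "b \<in> K"
      "\<And>\<alpha>. \<psi> \<alpha> (- \<alpha>) = scale (deg \<alpha> ^ 3) a + scale (deg \<alpha>) b"
    using diagonal_cubic[of K \<epsilon>] assms by metis
  define g where "g \<alpha> = (if \<alpha> = 0 then scale (- (1 / 2)) (a + b) else scale (1 / deg \<alpha>) (\<psi> 0 \<alpha>))" for \<alpha>
  have "\<psi> \<alpha> \<beta> = scale (deg \<beta> - deg \<alpha>) (g (\<alpha> + \<beta>)) +
      scale (if \<alpha> = - \<beta> then (deg \<alpha> ^ 3 - deg \<alpha>) / 12 else 0) (scale 12 a)" for \<alpha> \<beta>
  proof (cases "\<alpha> + \<beta> = 0")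
    case True
    then have \<beta>: "\<beta> = - \<alpha>" by (simp add: eq_neg_iff_add_eq_0 add.commute)
    have "scale (- deg \<alpha> - deg \<alpha>) (scale (- (1 / 2)) (a + b)) =
        scale (deg \<alpha>) a + scale (deg \<alpha>) b"
      unfolding scale_scale scale_right_distrib[symmetric] by (simp add: field_simps)
    moreover have "scale ((deg \<alpha> ^ 3 - deg \<alpha>) / 12) (scale 12 a) =
        scale (deg \<alpha> ^ 3) a - scale (deg \<alpha>) a"
      unfolding scale_scale scale_left_diff_distrib[symmetric] by simp
    ultimately show ?thesis
      by (simp only: \<beta> ab(3) g_def deg_minus minus_minus if_True right_minus) simp
  next
    case False
    moreover from this have "\<alpha> \<noteq> - \<beta>" by auto
    ultimately show ?thesis using off_diagonal[OF False] by (simp add: g_def)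
  qed
  moreover have "scale 12 a \<in> K" "\<And>\<alpha>. g \<alpha> \<in> K"
    unfolding g_def using ab K by (auto intro!: subspace_neg subspace_scale subspace_add)
  ultimately show ?thesis by blast
qed

end


section \<open>Central extensions\<close>

lemma (in lie_algebra) bracket_antisym:
  assumes "x \<in> lie_carrier L" "y \<in> lie_carrier L"
  shows "lie_bracket L x y = - lie_bracket L y x"
proof -
  have "x + y \<in> lie_carrier L" using assms subspace_carrier subspace_add by blast
  then have "0 = lie_bracket L x (x + y) + lie_bracket L y (x + y)"
    using bracket_self bracket_add_left assms by metis
  also have "\<dots> = lie_bracket L x y + lie_bracket L y x"
    using assms by (simp add: bracket_add_right bracket_self)
  finally show ?thesis by (simp add: eq_neg_iff_add_eq_0)
qed

lemma (in lie_algebra) bracket_center: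
  assumes "z \<in> lie_center L" "x \<in> lie_carrier L"
  shows "lie_bracket L x z = 0" "lie_bracket L z x = 0"
  using assms bracket_antisym[of z x] by (auto simp: lie_center_def)

lemma (in lie_algebra) bracket_add_central:
  assumes "x \<in> lie_carrier L" "y \<in> lie_carrier L" "z \<in> lie_center L" "w \<in> lie_center L"
  shows "lie_bracket L (x + z) (y + w) = lie_bracket L x y"
proof -
  have zw: "z \<in> lie_carrier L" "w \<in> lie_carrier L" using assms by (auto simp: lie_center_def)
  then have "x + z \<in> lie_carrier L" using assms subspace_carrier subspace_add by blast
  then show ?thesis using assms zw by (simp add: bracket_add_left bracket_add_right bracket_center)
qed

lemma cocycle_extension_sel [simp]:
  "lie_carrier (cocycle_extension L \<psi>) = lie_carrier L \<times> UNIV"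
  "lie_scale (cocycle_extension L \<psi>) c u = (lie_scale L c (fst u), c * snd u)"
  "lie_bracket (cocycle_extension L \<psi>) u v = (lie_bracket L (fst u) (fst v), \<psi> (fst u) (fst v))"
  by (simp_all add: cocycle_extension_def)

lemma lie_algebra_cocycle_extension:
  assumes "lie_algebra L" "two_cocycle L \<psi>"
  shows "lie_algebra (cocycle_extension L \<psi>)"
proof -
  interpret L: lie_algebra L by fact
  interpret V: vector_space "lie_scale (cocycle_extension L \<psi>)"
    by unfold_locales
      (auto simp: prod_eq_iff algebra_simps)
  have lin: "\<psi> (x + y) z = \<psi> x z + \<psi> y z" "\<psi> z (x + y) = \<psi> z x + \<psi> z y"
      "\<psi> (lie_scale L c x) z = c * \<psi> x z" "\<psi> z (lie_scale L c x) = c * \<psi> z x"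
    if "x \<in> lie_carrier L" "y \<in> lie_carrier L" "z \<in> lie_carrier L" for x y z c
    using assms(2) that by (auto simp: two_cocycle_def lie_linear_def)
  show ?thesis
  proof
    show "V.subspace (lie_carrier (cocycle_extension L \<psi>))"
      using L.subspace_carrier by (auto simp: V.subspace_def L.subspace_def zero_prod_def)
  qed (use assms(2) in \<open>auto simp: prod_eq_iff lin two_cocycle_def L.bracket_closed L.bracket_self
      L.bracket_add_left L.bracket_add_right L.bracket_scale_left L.bracket_scale_right L.jacobi\<close>)
qed

lemma central_extension_cocycle_extension:
  assumes "lie_algebra L" "two_cocycle L \<psi>"
  shows "central_extension L (cocycle_extension L \<psi>) fst"
proof -
  interpret L: lie_algebra L by fact
  have zero: "\<psi> x 0 = 0" if "x \<in> lie_carrier L" for x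
  proof -
    have "\<psi> x (lie_scale L 0 x) = 0"
      using assms(2) that by (simp add: two_cocycle_def lie_linear_def del: L.scale_zero_left)
    then show ?thesis by simp
  qed
  have zero_mem: "0 \<in> lie_carrier L" using L.subspace_carrier by (rule L.subspace_0)
  have bzero: "lie_bracket L x 0 = 0" if "x \<in> lie_carrier L" for x
    using L.bracket_add_right[OF that zero_mem zero_mem] by simp
  show ?thesis
    unfolding central_extension_def
    using assms lie_algebra_cocycle_extension[OF assms] zero_mem
    by (auto simp: lie_hom_def lie_linear_def lie_kernel_def lie_center_def zero bzero
        image_iff zero_prod_def)
qed

lemma lie_hom_add_scale:
  assumes "lie_hom E F f" "x \<in> lie_carrier E"
  shows "y \<in> lie_carrier E \<Longrightarrow> f (x + y) = f x + f y" "f (lie_scale E c x) = lie_scale F c (f x)"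
    "f x \<in> lie_carrier F" "y \<in> lie_carrier E \<Longrightarrow> f (lie_bracket E x y) = lie_bracket F (f x) (f y)"
  using assms by (auto simp: lie_hom_def lie_linear_def)

lemma lie_kernel_diff:
  assumes "lie_algebra F" "lie_algebra L" "lie_hom F L q" "x \<in> lie_carrier F" "y \<in> lie_carrier F"
  shows "x - y \<in> lie_kernel F q \<longleftrightarrow> q x = q y"
proof -
  interpret F: lie_algebra F by fact
  interpret L: lie_algebra L by fact
  have mem: "x - y \<in> lie_carrier F" using assms F.subspace_carrier F.subspace_diff by blast
  have "q x = q (x - y) + q y" using lie_hom_add_scale(1)[OF assms(3) mem assms(5)] by simp
  then show ?thesis using mem by (auto simp: lie_kernel_def)
qed

lemma subspace_lie_kernel:
  assumes "lie_algebra F" "lie_algebra L" "lie_hom F L q"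
  shows "module.subspace (lie_scale F) (lie_kernel F q)"
proof -
  interpret F: lie_algebra F by fact
  interpret L: lie_algebra L by fact
  have 0: "0 \<in> lie_carrier F" by (rule F.subspace_0[OF F.subspace_carrier])
  have "q 0 = 0" using lie_hom_add_scale(2)[OF assms(3) 0, of 0] by simp
  then show ?thesis
    unfolding F.subspace_def lie_kernel_def using 0 F.subspace_carrier
    by (auto simp: lie_hom_add_scale[OF assms(3)] F.subspace_add F.subspace_scale)
qed

text \<open>Two lifts differ by central elements, which brackets do not see; hence the lifts agree on all
  brackets, and these span a perfect algebra.\<close>

lemma lifts_unique:
  assumes "lie_algebra E" and F: "central_extension L F q"
    and perfect: "lie_carrier E \<subseteq> module.span (lie_scale E)
      {lie_bracket E x y |x y. x \<in> lie_carrier E \<and> y \<in> lie_carrier E}"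
    and f: "lie_hom E F f" and g: "lie_hom E F g"
    and qfg: "\<And>x. x \<in> lie_carrier E \<Longrightarrow> q (g x) = q (f x)"
    and x: "x \<in> lie_carrier E"
  shows "g x = f x"
proof -
  interpret E: lie_algebra E by fact
  interpret F: lie_algebra F using F by (simp add: central_extension_def)
  define S where "S = {x \<in> lie_carrier E. g x = f x}"
  have zero: "g 0 = 0" "f 0 = 0"
    using lie_hom_add_scale(2)[OF f x, of 0] lie_hom_add_scale(2)[OF g x, of 0] by simp_all
  have "E.subspace S"
    unfolding E.subspace_def S_def using E.subspace_carrier
    by (auto simp: zero E.subspace_0 E.subspace_add E.subspace_scale
        lie_hom_add_scale[OF f] lie_hom_add_scale[OF g])
  moreover have "lie_bracket E x y \<in> S" if xy: "x \<in> lie_carrier E" "y \<in> lie_carrier E" for x y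
  proof -
    have "g z - f z \<in> lie_center F" if "z \<in> lie_carrier E" for z
      using lie_kernel_diff[of F L q "g z" "f z"] F qfg that lie_hom_add_scale(3)[OF f that]
        lie_hom_add_scale(3)[OF g that]
      by (auto simp: central_extension_def)
    from F.bracket_add_central[OF _ _ this[OF xy(1)] this[OF xy(2)], of "f x" "f y"]
    have "lie_bracket F (g x) (g y) = lie_bracket F (f x) (f y)"
      using xy by (simp add: lie_hom_add_scale(3)[OF f])
    then show ?thesis
      unfolding S_def using xy
      by (simp add: lie_hom_add_scale(4)[OF f] lie_hom_add_scale(4)[OF g] E.bracket_closed)
  qed
  ultimately have "lie_carrier E \<subseteq> S"
    using perfect by (intro order_trans[OF perfect] E.span_minimal) auto
  with x show ?thesis by (auto simp: S_def)
qed


section \<open>Laurent polynomials\<close>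

lemma lookup_laurent_scale [simp]:
  "Poly_Mapping.lookup (laurent_scale c a) \<alpha> = c * Poly_Mapping.lookup a \<alpha>"
  unfolding laurent_scale_def mult_map_scale_conv_mult[symmetric]
  by (simp add: Poly_Mapping.map.rep_eq when_def)

lemma laurent_scale_simps [simp]:
  "laurent_scale c (Poly_Mapping.single \<alpha> x) = Poly_Mapping.single \<alpha> (c * x)"
  "laurent_scale c a * b = laurent_scale c (a * b)"
  "a * laurent_scale c b = laurent_scale c (a * b)"
  by (simp_all add: laurent_scale_def mult_single mult_ac)

lemma vector_space_laurent_scale: "vector_space (laurent_scale :: _ \<Rightarrow> 'n::finite laurent \<Rightarrow> _)"
  by unfold_locales (auto intro!: poly_mapping_eqI simp: lookup_add algebra_simps)

lemma update_eq_add_single: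
  "\<alpha> \<notin> Poly_Mapping.keys f \<Longrightarrow> Poly_Mapping.update \<alpha> c f = f + Poly_Mapping.single \<alpha> c"
  by (intro poly_mapping_eqI) (auto simp: lookup_add lookup_update lookup_single in_keys_iff when_def)

text \<open>Identities between multilinear expressions in Laurent polynomials are checked on monomials by
  applying this rule once for each argument.\<close>

lemma additive_on_monomials_eqI:
  fixes F G :: "('g \<Rightarrow>\<^sub>0 'k::comm_monoid_add) \<Rightarrow> 'v::ab_group_add"
  assumes "\<And>a b. F (a + b) = F a + F b" "\<And>a b. G (a + b) = G a + G b"
    and "\<And>\<alpha> c. F (Poly_Mapping.single \<alpha> c) = G (Poly_Mapping.single \<alpha> c)"
  shows "F a = G a"
proof (induction a rule: update_induct)
  case const
  show ?case using assms(1)[of 0 0] assms(2)[of 0 0] by simp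
next
  case (update f \<alpha> c)
  then show ?case using assms by (simp add: update_eq_add_single)
qed

definition linear_extension ::
  "('k \<Rightarrow> 'v \<Rightarrow> 'v) \<Rightarrow> ('g \<Rightarrow> 'v) \<Rightarrow> ('g \<Rightarrow>\<^sub>0 'k::zero) \<Rightarrow> 'v::ab_group_add" where
  "linear_extension s h a = (\<Sum>\<alpha>\<in>Poly_Mapping.keys a. s (Poly_Mapping.lookup a \<alpha>) (h \<alpha>))"

context vector_space begin

lemma linear_extension_superset:
  assumes "finite A" "Poly_Mapping.keys a \<subseteq> A"
  shows "linear_extension scale h a = (\<Sum>\<alpha>\<in>A. scale (Poly_Mapping.lookup a \<alpha>) (h \<alpha>))"
  unfolding linear_extension_def
  by (intro sum.mono_neutral_left assms) (auto simp: in_keys_iff)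

lemma linear_extension_add:
  "linear_extension scale h (a + b) = linear_extension scale h a + linear_extension scale h b"
proof -
  let ?A = "Poly_Mapping.keys a \<union> Poly_Mapping.keys b"
  show ?thesis
    by (subst (1 2 3) linear_extension_superset[of ?A])
      (auto simp: keys_add lookup_add scale_left_distrib sum.distrib Poly_Mapping.keys_add[THEN subsetD])
qed

lemma linear_extension_single [simp]:
  "linear_extension scale h (Poly_Mapping.single \<alpha> c) = scale c (h \<alpha>)"
  by (simp add: linear_extension_def)

lemma linear_extension_in:
  "subspace K \<Longrightarrow> (\<And>\<alpha>. h \<alpha> \<in> K) \<Longrightarrow> linear_extension scale h a \<in> K"
  unfolding linear_extension_def by (auto intro!: subspace_sum subspace_scale)

end

lemma linear_extension_laurent_scale:
  assumes "vector_space s"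
  shows "linear_extension s h (laurent_scale c a) = s c (linear_extension s h a)"
proof -
  interpret vector_space s by fact
  have "Poly_Mapping.keys (laurent_scale c a) \<subseteq> Poly_Mapping.keys a" by (auto simp: in_keys_iff)
  from linear_extension_superset[OF finite_keys this] show ?thesis
    by (simp add: linear_extension_def scale_sum_right)
qed

lemma linear_extension_cmult:
  fixes h :: "'g \<Rightarrow> 'k::field"
  shows "linear_extension (*) (\<lambda>\<alpha>. c * h \<alpha>) a = c * linear_extension (*) h a"
    "linear_extension (*) (\<lambda>\<alpha>. h \<alpha> + h' \<alpha>) a = linear_extension (*) h a + linear_extension (*) h' a"
  by (simp_all add: linear_extension_def sum_distrib_left sum.distrib algebra_simps)


section \<open>The coefficients of the Witt algebra and their cocycle\<close>

lemma dot_simps [simp]: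
  "dot \<mu> (\<alpha> + \<beta>) = dot \<mu> \<alpha> + dot \<mu> \<beta>" "dot \<mu> 0 = 0" "dot \<mu> (- \<alpha>) = - dot \<mu> \<alpha>"
  "dot \<mu> (\<alpha> - \<beta>) = dot \<mu> \<alpha> - dot \<mu> \<beta>"
  by (simp_all add: dot_def algebra_simps sum.distrib sum_negf sum_subtractf)

text \<open>The derivation \<open>d\<^sub>\<mu>\<close> is diagonal in the monomial basis, with the degrees as eigenvalues.\<close>

lemma lookup_d_mu [simp]:
  "Poly_Mapping.lookup (d_mu \<mu> f) \<alpha> = dot \<mu> \<alpha> * Poly_Mapping.lookup f \<alpha>"
proof -
  have "laurent_monom (axis i 1) * laurent_partial i f =
      (\<Sum>\<beta>\<in>Poly_Mapping.keys f. Poly_Mapping.single \<beta> (of_int (\<beta> $ i) * Poly_Mapping.lookup f \<beta>))" for i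
    by (simp add: laurent_partial_def laurent_monom_def sum_distrib_left mult_single)
  moreover have "(\<Sum>\<beta>\<in>Poly_Mapping.keys f. Poly_Mapping.lookup
        (Poly_Mapping.single \<beta> (of_int (\<beta> $ i) * Poly_Mapping.lookup f \<beta>)) \<alpha>) =
      of_int (\<alpha> $ i) * Poly_Mapping.lookup f \<alpha>" for i
    by (simp add: lookup_single when_def sum.delta in_keys_iff)
  ultimately show ?thesis
    by (simp add: d_mu_def lookup_sum dot_def sum_distrib_right mult.assoc)
qed

lemma d_mu_add [simp]: "d_mu \<mu> (f + g) = d_mu \<mu> f + d_mu \<mu> g"
  and d_mu_diff [simp]: "d_mu \<mu> (f - g) = d_mu \<mu> f - d_mu \<mu> g"
  and d_mu_scale [simp]: "d_mu \<mu> (laurent_scale c f) = laurent_scale c (d_mu \<mu> f)"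
  by (auto intro!: poly_mapping_eqI simp: lookup_add lookup_minus algebra_simps)

lemma d_mu_single [simp]:
  "d_mu \<mu> (Poly_Mapping.single \<alpha> c) = Poly_Mapping.single \<alpha> (dot \<mu> \<alpha> * c)"
  by (rule poly_mapping_eqI) (simp add: lookup_single when_def)

lemma d_mu_mult: "d_mu \<mu> (f * g) = d_mu \<mu> f * g + f * d_mu \<mu> g"
proof (rule additive_on_monomials_eqI[where F = "\<lambda>f. d_mu \<mu> (f * g)"])
  fix \<alpha> c
  show "d_mu \<mu> (Poly_Mapping.single \<alpha> c * g) =
      d_mu \<mu> (Poly_Mapping.single \<alpha> c) * g + Poly_Mapping.single \<alpha> c * d_mu \<mu> g"
    by (rule additive_on_monomials_eqI[where F = "\<lambda>g. d_mu \<mu> (Poly_Mapping.single \<alpha> c * g)"])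
      (simp_all add: algebra_simps mult_single flip: single_add)
qed (simp_all add: algebra_simps)

lemma laurent_scale_diff: "laurent_scale c (a - b) = laurent_scale c a - laurent_scale c b"
  by (simp add: laurent_scale_def algebra_simps)

text \<open>The bracket of \<open>a d\<^sub>\<mu>\<close> and \<open>b d\<^sub>\<mu>\<close>, in terms of the coefficients \<open>a\<close> and \<open>b\<close>.\<close>

definition witt_coeff_bracket ::
  "complex ^ 'n \<Rightarrow> 'n::finite laurent \<Rightarrow> 'n laurent \<Rightarrow> 'n laurent" where
  "witt_coeff_bracket \<mu> a b = a * d_mu \<mu> b - b * d_mu \<mu> a"

lemma witt_coeff_bracket_simps:
  "witt_coeff_bracket \<mu> (a + a') b = witt_coeff_bracket \<mu> a b + witt_coeff_bracket \<mu> a' b"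
  "witt_coeff_bracket \<mu> b (a + a') = witt_coeff_bracket \<mu> b a + witt_coeff_bracket \<mu> b a'"
  "witt_coeff_bracket \<mu> (Poly_Mapping.single \<alpha> x) (Poly_Mapping.single \<beta> y) =
    Poly_Mapping.single (\<alpha> + \<beta>) (x * y * (dot \<mu> \<beta> - dot \<mu> \<alpha>))"
  "witt_coeff_bracket \<mu> (laurent_scale c a) b = laurent_scale c (witt_coeff_bracket \<mu> a b)"
  "witt_coeff_bracket \<mu> a (laurent_scale c b) = laurent_scale c (witt_coeff_bracket \<mu> a b)"
  "witt_coeff_bracket \<mu> a a = 0"
  by (simp_all add: witt_coeff_bracket_def algebra_simps mult_single laurent_scale_diff flip: single_diff)

lemma witt_coeff_bracket_jacobi:
  "witt_coeff_bracket \<mu> a (witt_coeff_bracket \<mu> b c) +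
    witt_coeff_bracket \<mu> b (witt_coeff_bracket \<mu> c a) +
    witt_coeff_bracket \<mu> c (witt_coeff_bracket \<mu> a b) = 0"
  by (simp add: witt_coeff_bracket_def d_mu_mult algebra_simps)

lemma witt_sel [simp]:
  "lie_carrier (witt \<mu>) = range (vfield \<mu>)"
  "lie_scale (witt \<mu>) c (vfield \<mu> a) = vfield \<mu> (laurent_scale c a)"
  "lie_bracket (witt \<mu>) (vfield \<mu> a) (vfield \<mu> b) = vfield \<mu> (witt_coeff_bracket \<mu> a b)"
  by (auto simp: witt_def vfield_def witt_coeff_bracket_def d_mu_mult algebra_simps)

lemma vfield_add: "vfield \<mu> a + vfield \<mu> b = vfield \<mu> (a + b)"
  and vfield_0: "vfield \<mu> 0 = 0"
  by (auto simp: vfield_def algebra_simps)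

lemma zero_in_range_vfield [simp]: "0 \<in> range (vfield \<mu>)"
  by (metis vfield_0 rangeI)

lemma lie_algebra_witt: "lie_algebra (witt \<mu>)"
proof -
  interpret L: vector_space "laurent_scale :: _ \<Rightarrow> 'a laurent \<Rightarrow> _" by (rule vector_space_laurent_scale)
  interpret V: vector_space "lie_scale (witt \<mu>)"
    by unfold_locales (auto simp: witt_def fun_eq_iff L.scale_right_distrib L.scale_left_distrib)
  show ?thesis
  proof
    show "V.subspace (lie_carrier (witt \<mu>))"
      unfolding V.subspace_def by (auto simp: vfield_add)
  qed (auto simp: vfield_add witt_coeff_bracket_simps witt_coeff_bracket_jacobi vfield_0)
qed

lemma generic_exponent:
  assumes "generic (\<mu> :: complex ^ 'n::finite)"
  obtains \<epsilon> where "\<epsilon> \<noteq> 0" "dot \<mu> \<epsilon> \<noteq> 0"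
proof -
  obtain i :: 'n where True by blast
  have "axis i (1::int) \<noteq> 0" by simp
  moreover from this have "dot \<mu> (axis i 1) \<noteq> 0" using assms by (auto simp: generic_def)
  ultimately show ?thesis by (rule that)
qed

text \<open>Applied to one monomial of nonzero degree, which is an invertible Laurent polynomial, a vector
  field already reveals its coefficient.\<close>

lemma inj_vfield:
  assumes "generic \<mu>"
  shows "inj (vfield \<mu>)"
proof (rule injI)
  fix a b assume eq: "vfield \<mu> a = vfield \<mu> b"
  obtain \<epsilon> where \<epsilon>: "dot \<mu> \<epsilon> \<noteq> 0" using generic_exponent assms by metis
  have "a * Poly_Mapping.single \<epsilon> (dot \<mu> \<epsilon>) = b * Poly_Mapping.single \<epsilon> (dot \<mu> \<epsilon>)"
    using fun_cong[OF eq, of "laurent_monom \<epsilon>"] by (simp add: vfield_def laurent_monom_def)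
  from arg_cong[OF this, of "\<lambda>f. f * Poly_Mapping.single (- \<epsilon>) (1 / dot \<mu> \<epsilon>)"] show "a = b"
    using \<epsilon> by (simp add: mult.assoc mult_single)
qed

lemma witt_coeff_vfield [simp]: "generic \<mu> \<Longrightarrow> witt_coeff \<mu> (vfield \<mu> a) = a"
  by (simp add: witt_coeff_def the_inv_f_f inj_vfield)

definition virasoro_value :: "complex ^ 'n::finite \<Rightarrow> int ^ 'n \<Rightarrow> int ^ 'n \<Rightarrow> complex" where
  "virasoro_value \<mu> \<alpha> \<beta> = (if \<alpha> = - \<beta> then (dot \<mu> \<alpha> ^ 3 - dot \<mu> \<alpha>) / 12 else 0)"

definition coeff_cocycle :: "complex ^ 'n::finite \<Rightarrow> 'n laurent \<Rightarrow> 'n laurent \<Rightarrow> complex" where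
  "coeff_cocycle \<mu> a b =
    linear_extension (*) (\<lambda>\<alpha>. linear_extension (*) (virasoro_value \<mu> \<alpha>) b) a"

lemma C_mu_vfield:
  assumes "generic \<mu>"
  shows "C_mu \<mu> (vfield \<mu> a) (vfield \<mu> b) = coeff_cocycle \<mu> a b"
  using assms by (simp add: C_mu_def coeff_cocycle_def linear_extension_def virasoro_value_def
      sum_distrib_left mult.assoc)

lemma vector_space_complex: "vector_space ((*) :: complex \<Rightarrow> complex \<Rightarrow> complex)"
  by unfold_locales (auto simp: algebra_simps)

lemma coeff_cocycle_simps:
  "coeff_cocycle \<mu> (a + a') b = coeff_cocycle \<mu> a b + coeff_cocycle \<mu> a' b"
  "coeff_cocycle \<mu> b (a + a') = coeff_cocycle \<mu> b a + coeff_cocycle \<mu> b a'"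
  "coeff_cocycle \<mu> (laurent_scale c a) b = c * coeff_cocycle \<mu> a b"
  "coeff_cocycle \<mu> a (laurent_scale c b) = c * coeff_cocycle \<mu> a b"
  "coeff_cocycle \<mu> (Poly_Mapping.single \<alpha> x) (Poly_Mapping.single \<beta> y) = x * y * virasoro_value \<mu> \<alpha> \<beta>"
  by (simp_all add: coeff_cocycle_def linear_extension_cmult
      vector_space.linear_extension_add[OF vector_space_complex]
      vector_space.linear_extension_single[OF vector_space_complex]
      linear_extension_laurent_scale[OF vector_space_complex])

lemma virasoro_value_antisym: "virasoro_value \<mu> \<alpha> \<beta> = - virasoro_value \<mu> \<beta> \<alpha>"
  by (auto simp: virasoro_value_def field_simps)

text \<open>All terms vanish unless \<open>\<gamma> = - \<alpha> - \<beta>\<close>, when this is a polynomial identity in two variables.\<close>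

lemma virasoro_value_cocycle:
  "(dot \<mu> \<gamma> - dot \<mu> \<beta>) * virasoro_value \<mu> \<alpha> (\<beta> + \<gamma>) +
   (dot \<mu> \<alpha> - dot \<mu> \<gamma>) * virasoro_value \<mu> \<beta> (\<gamma> + \<alpha>) +
   (dot \<mu> \<beta> - dot \<mu> \<alpha>) * virasoro_value \<mu> \<gamma> (\<alpha> + \<beta>) = 0"
proof (cases "\<alpha> + \<beta> + \<gamma> = 0")
  case True
  then have \<gamma>: "\<gamma> = - \<alpha> - \<beta>" by (simp add: algebra_simps eq_neg_iff_add_eq_0)
  define x y where "x = dot \<mu> \<alpha>" and "y = dot \<mu> \<beta>"
  have "(- x - y - y) * (x ^ 3 - x) + (x - (- x - y)) * (y ^ 3 - y) +
      (y - x) * ((- x - y) ^ 3 - (- x - y)) = 0"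
    by algebra
  then have "((- x - y - y) * (x ^ 3 - x) + (x - (- x - y)) * (y ^ 3 - y) +
      (y - x) * ((- x - y) ^ 3 - (- x - y))) / 12 = 0"
    by simp
  then show ?thesis
    unfolding \<gamma> virasoro_value_def
    by (simp add: add_divide_distrib x_def y_def)
next
  case False
  moreover have "\<alpha> + \<beta> + \<gamma> = 0" if "\<alpha> = - (\<beta> + \<gamma>) \<or> \<beta> = - (\<gamma> + \<alpha>) \<or> \<gamma> = - (\<alpha> + \<beta>)"
    using that by auto
  ultimately have "\<alpha> \<noteq> - (\<beta> + \<gamma>)" "\<beta> \<noteq> - (\<gamma> + \<alpha>)" "\<gamma> \<noteq> - (\<alpha> + \<beta>)"
    by blast+
  then show ?thesis by (simp add: virasoro_value_def)
qed

lemma coeff_cocycle_antisym: "coeff_cocycle \<mu> a b = - coeff_cocycle \<mu> b a"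
proof (rule additive_on_monomials_eqI[where F = "\<lambda>a. coeff_cocycle \<mu> a b"])
  fix \<alpha> x
  show "coeff_cocycle \<mu> (Poly_Mapping.single \<alpha> x) b = - coeff_cocycle \<mu> b (Poly_Mapping.single \<alpha> x)"
    by (rule additive_on_monomials_eqI[where F = "coeff_cocycle \<mu> _"])
      (use virasoro_value_antisym[of \<mu> \<alpha>] in \<open>auto simp: coeff_cocycle_simps\<close>)
qed (simp_all add: coeff_cocycle_simps)

lemma coeff_cocycle_cyclic:
  "coeff_cocycle \<mu> a (witt_coeff_bracket \<mu> b c) + coeff_cocycle \<mu> b (witt_coeff_bracket \<mu> c a) +
    coeff_cocycle \<mu> c (witt_coeff_bracket \<mu> a b) = 0"
proof -
  define T where "T a b c = coeff_cocycle \<mu> a (witt_coeff_bracket \<mu> b c) +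
    coeff_cocycle \<mu> b (witt_coeff_bracket \<mu> c a) + coeff_cocycle \<mu> c (witt_coeff_bracket \<mu> a b)" for a b c
  have add: "T (a + a') b c = T a b c + T a' b c" "T b (a + a') c = T b a c + T b a' c"
      "T b c (a + a') = T b c a + T b c a'" for a a' b c
    by (simp_all add: T_def coeff_cocycle_simps witt_coeff_bracket_simps)
  have "T (Poly_Mapping.single \<alpha> x) (Poly_Mapping.single \<beta> y) (Poly_Mapping.single \<gamma> z) = 0" for \<alpha> \<beta> \<gamma> x y z
  proof -
    have "T (Poly_Mapping.single \<alpha> x) (Poly_Mapping.single \<beta> y) (Poly_Mapping.single \<gamma> z) =
      x * y * z * ((dot \<mu> \<gamma> - dot \<mu> \<beta>) * virasoro_value \<mu> \<alpha> (\<beta> + \<gamma>) +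
        (dot \<mu> \<alpha> - dot \<mu> \<gamma>) * virasoro_value \<mu> \<beta> (\<gamma> + \<alpha>) +
        (dot \<mu> \<beta> - dot \<mu> \<alpha>) * virasoro_value \<mu> \<gamma> (\<alpha> + \<beta>))"
      by (simp only: T_def coeff_cocycle_simps witt_coeff_bracket_simps) (simp only: distrib_left mult_ac)
    then show ?thesis by (simp add: virasoro_value_cocycle)
  qed
  then have "T (Poly_Mapping.single \<alpha> x) (Poly_Mapping.single \<beta> y) c = 0" for \<alpha> \<beta> x y c
    by - (rule additive_on_monomials_eqI[where F = "T _ _" and G = "\<lambda>_. 0"]; simp add: add)
  then have "T (Poly_Mapping.single \<alpha> x) b c = 0" for \<alpha> x b c
    by - (rule additive_on_monomials_eqI[where F = "\<lambda>b. T _ b c" and G = "\<lambda>_. 0"]; simp add: add)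
  then have "T a b c = 0"
    by - (rule additive_on_monomials_eqI[where F = "\<lambda>a. T a b c" and G = "\<lambda>_. 0"]; simp add: add)
  then show ?thesis by (simp add: T_def)
qed

lemma two_cocycle_C_mu:
  assumes "generic \<mu>"
  shows "two_cocycle (witt \<mu>) (C_mu \<mu>)"
proof -
  have "coeff_cocycle \<mu> a a = 0" for a
    using coeff_cocycle_antisym[of \<mu> a a] by simp
  then show ?thesis
    unfolding two_cocycle_def lie_linear_def
    by (auto simp: C_mu_vfield[OF assms] vfield_add coeff_cocycle_simps coeff_cocycle_cyclic)
qed

lemma witt_basis_bracket:
  "lie_bracket (witt \<mu>) (witt_e \<mu> \<alpha>) (witt_e \<mu> \<beta>) =
    lie_scale (witt \<mu>) (dot \<mu> \<beta> - dot \<mu> \<alpha>) (witt_e \<mu> (\<alpha> + \<beta>))"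
  by (simp add: witt_e_def laurent_monom_def witt_coeff_bracket_simps)

lemma witt_e_carrier [simp]: "witt_e \<mu> \<alpha> \<in> lie_carrier (witt \<mu>)"
  by (simp add: witt_e_def)

lemma C_mu_basis:
  assumes "generic \<mu>"
  shows "C_mu \<mu> (witt_e \<mu> \<alpha>) (witt_e \<mu> \<beta>) = virasoro_value \<mu> \<alpha> \<beta>"
  by (simp add: witt_e_def C_mu_vfield assms laurent_monom_def coeff_cocycle_simps)


section \<open>Cohomology of the solenoidal Witt algebra\<close>

text \<open>The primitive of the coboundary is the linear extension of the function \<open>g\<close> of the normal form of
  the cocycle on basis elements.\<close>

lemma witt_cocycle_decomposition:
  assumes \<mu>: "generic \<mu>" and \<psi>: "two_cocycle (witt \<mu>) \<psi>"
  shows "\<exists>k. two_coboundary (witt \<mu>) (\<lambda>x y. \<psi> x y - k * C_mu \<mu> x y)"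
proof -
  interpret L: lie_algebra "witt \<mu>" by (rule lie_algebra_witt)
  let ?e = "witt_e \<mu>"
  have add: "\<psi> (x + y) z = \<psi> x z + \<psi> y z" "\<psi> z (x + y) = \<psi> z x + \<psi> z y"
    if "x \<in> lie_carrier (witt \<mu>)" "y \<in> lie_carrier (witt \<mu>)" "z \<in> lie_carrier (witt \<mu>)" for x y z
    using \<psi> that by (auto simp: two_cocycle_def lie_linear_def simp del: witt_sel)
  have scale: "\<psi> (lie_scale (witt \<mu>) c x) z = c * \<psi> x z" "\<psi> z (lie_scale (witt \<mu>) c x) = c * \<psi> z x"
    if "x \<in> lie_carrier (witt \<mu>)" "z \<in> lie_carrier (witt \<mu>)" for x z c
    using \<psi> that by (auto simp: two_cocycle_def lie_linear_def simp del: witt_sel)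
  have self: "\<psi> x x = 0" if "x \<in> lie_carrier (witt \<mu>)" for x
    using \<psi> that by (auto simp: two_cocycle_def)
  interpret C: graded_cocycle "(*) :: complex \<Rightarrow> _" "dot \<mu>" "\<lambda>\<alpha> \<beta>. \<psi> (?e \<alpha>) (?e \<beta>)"
  proof
    fix \<alpha> \<beta> \<gamma>
    show "dot \<mu> \<alpha> = 0 \<Longrightarrow> \<alpha> = 0" using \<mu> by (auto simp: generic_def)
    have "?e \<alpha> + ?e \<beta> \<in> lie_carrier (witt \<mu>)"
      using L.subspace_add[OF L.subspace_carrier] witt_e_carrier by blast
    then have "0 = \<psi> (?e \<alpha> + ?e \<beta>) (?e \<alpha> + ?e \<beta>)"
      by (rule self[symmetric])
    also have "\<dots> = \<psi> (?e \<alpha>) (?e \<beta>) + \<psi> (?e \<beta>) (?e \<alpha>)"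
      using \<open>?e \<alpha> + ?e \<beta> \<in> _\<close> self[of "?e \<alpha>"] self[of "?e \<beta>"]
      by (simp add: add del: witt_sel)
    finally show "\<psi> (?e \<alpha>) (?e \<beta>) = - \<psi> (?e \<beta>) (?e \<alpha>)" by (simp add: eq_neg_iff_add_eq_0)
    have "\<psi> (?e \<alpha>) (lie_bracket (witt \<mu>) (?e \<beta>) (?e \<gamma>)) + \<psi> (?e \<beta>) (lie_bracket (witt \<mu>) (?e \<gamma>) (?e \<alpha>)) +
        \<psi> (?e \<gamma>) (lie_bracket (witt \<mu>) (?e \<alpha>) (?e \<beta>)) = 0"
      using \<psi> witt_e_carrier unfolding two_cocycle_def by blast
    then show "(dot \<mu> \<gamma> - dot \<mu> \<beta>) * \<psi> (?e \<alpha>) (?e (\<beta> + \<gamma>)) +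
        (dot \<mu> \<alpha> - dot \<mu> \<gamma>) * \<psi> (?e \<beta>) (?e (\<gamma> + \<alpha>)) +
        (dot \<mu> \<beta> - dot \<mu> \<alpha>) * \<psi> (?e \<gamma>) (?e (\<alpha> + \<beta>)) = 0"
      by (simp add: witt_basis_bracket scale del: witt_sel)
  qed (simp_all add: algebra_simps)
  obtain \<epsilon> :: "int ^ 'a" where "\<epsilon> \<noteq> 0" using generic_exponent[OF \<mu>] by blast
  from C.normal_form[OF C.subspace_UNIV UNIV_I this]
  obtain g k where "k \<in> UNIV \<and> (\<forall>\<alpha>. g \<alpha> \<in> UNIV) \<and> (\<forall>\<alpha> \<beta>. \<psi> (?e \<alpha>) (?e \<beta>) =
      (dot \<mu> \<beta> - dot \<mu> \<alpha>) * g (\<alpha> + \<beta>) + virasoro_value \<mu> \<alpha> \<beta> * k)"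
    unfolding virasoro_value_def by (elim exE)
  then have gk: "\<psi> (?e \<alpha>) (?e \<beta>) =
      (dot \<mu> \<beta> - dot \<mu> \<alpha>) * g (\<alpha> + \<beta>) + virasoro_value \<mu> \<alpha> \<beta> * k" for \<alpha> \<beta>
    by blast
  define G where "G = linear_extension (*) g \<circ> witt_coeff \<mu>"
  have G: "G (vfield \<mu> a) = linear_extension (*) g a" for a using \<mu> by (simp add: G_def)
  have single: "vfield \<mu> (Poly_Mapping.single \<alpha> x) = lie_scale (witt \<mu>) x (?e \<alpha>)" for \<alpha> x
    by (simp add: witt_e_def laurent_monom_def)
  have \<psi>_add: "\<psi> (vfield \<mu> (a + a')) (vfield \<mu> b) = \<psi> (vfield \<mu> a) (vfield \<mu> b) + \<psi> (vfield \<mu> a') (vfield \<mu> b)"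
    "\<psi> (vfield \<mu> b) (vfield \<mu> (a + a')) = \<psi> (vfield \<mu> b) (vfield \<mu> a) + \<psi> (vfield \<mu> b) (vfield \<mu> a')" for a a' b
    by (simp_all add: add flip: vfield_add)
  have "\<psi> (vfield \<mu> a) (vfield \<mu> b) =
      k * coeff_cocycle \<mu> a b + linear_extension (*) g (witt_coeff_bracket \<mu> a b)" for a b
  proof (rule additive_on_monomials_eqI[where F = "\<lambda>a. \<psi> (vfield \<mu> a) (vfield \<mu> b)"])
    fix \<alpha> x
    show "\<psi> (vfield \<mu> (Poly_Mapping.single \<alpha> x)) (vfield \<mu> b) =
        k * coeff_cocycle \<mu> (Poly_Mapping.single \<alpha> x) b +
        linear_extension (*) g (witt_coeff_bracket \<mu> (Poly_Mapping.single \<alpha> x) b)"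
    proof (rule additive_on_monomials_eqI[where F = "\<lambda>b. \<psi> (vfield \<mu> _) (vfield \<mu> b)"])
      fix \<beta> y
      have "\<psi> (lie_scale (witt \<mu>) x (?e \<alpha>)) (lie_scale (witt \<mu>) y (?e \<beta>)) = x * (y * \<psi> (?e \<alpha>) (?e \<beta>))"
        by (simp only: scale witt_e_carrier L.subspace_scale[OF L.subspace_carrier])
          (rule mult.left_commute)
      also have "\<dots> = k * (x * y * virasoro_value \<mu> \<alpha> \<beta>) + x * y * (dot \<mu> \<beta> - dot \<mu> \<alpha>) * g (\<alpha> + \<beta>)"
        by (simp only: gk distrib_left mult_ac add_ac)
      finally show "\<psi> (vfield \<mu> (Poly_Mapping.single \<alpha> x)) (vfield \<mu> (Poly_Mapping.single \<beta> y)) =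
          k * coeff_cocycle \<mu> (Poly_Mapping.single \<alpha> x) (Poly_Mapping.single \<beta> y) +
          linear_extension (*) g (witt_coeff_bracket \<mu> (Poly_Mapping.single \<alpha> x) (Poly_Mapping.single \<beta> y))"
        by (simp only: single coeff_cocycle_simps witt_coeff_bracket_simps C.linear_extension_single)
    qed (simp_all add: \<psi>_add coeff_cocycle_simps witt_coeff_bracket_simps C.linear_extension_add algebra_simps)
  qed (simp_all add: \<psi>_add coeff_cocycle_simps witt_coeff_bracket_simps C.linear_extension_add algebra_simps)
  then have "\<forall>x\<in>lie_carrier (witt \<mu>). \<forall>y\<in>lie_carrier (witt \<mu>).
      \<psi> x y - k * C_mu \<mu> x y = G (lie_bracket (witt \<mu>) x y)"
    by (auto simp: C_mu_vfield[OF \<mu>] G)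
  moreover have "lie_linear (witt \<mu>) (*) G"
    by (auto simp: lie_linear_def vfield_add G C.linear_extension_add
        linear_extension_laurent_scale[OF vector_space_complex])
  ultimately show ?thesis unfolding two_coboundary_def by blast
qed

text \<open>On the pairs \<open>(e\<^sub>\<alpha>, e\<^sub>-\<^sub>\<alpha>)\<close> a coboundary is linear in the degree of \<open>\<alpha>\<close>, while the cocycle is a
  genuine cubic: \<open>\<alpha> = \<epsilon>\<close> and \<open>\<alpha> = 2\<epsilon>\<close> are incompatible.\<close>

lemma C_mu_not_coboundary:
  assumes \<mu>: "generic \<mu>"
  shows "\<not> two_coboundary (witt \<mu>) (C_mu \<mu>)"
proof
  assume "two_coboundary (witt \<mu>) (C_mu \<mu>)"
  then obtain g where g: "lie_linear (witt \<mu>) (*) g"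
    "\<And>x y. x \<in> lie_carrier (witt \<mu>) \<Longrightarrow> y \<in> lie_carrier (witt \<mu>) \<Longrightarrow>
      C_mu \<mu> x y = g (lie_bracket (witt \<mu>) x y)"
    unfolding two_coboundary_def by blast
  have at_0: "(dot \<mu> \<alpha> ^ 3 - dot \<mu> \<alpha>) / 12 = - 2 * dot \<mu> \<alpha> * g (witt_e \<mu> 0)" for \<alpha>
  proof -
    have "virasoro_value \<mu> \<alpha> (- \<alpha>) = g (lie_scale (witt \<mu>) (- 2 * dot \<mu> \<alpha>) (witt_e \<mu> 0))"
      using g(2)[of "witt_e \<mu> \<alpha>" "witt_e \<mu> (- \<alpha>)"]
      by (simp add: C_mu_basis[OF \<mu>] witt_basis_bracket del: witt_sel)
    also have "\<dots> = - 2 * dot \<mu> \<alpha> * g (witt_e \<mu> 0)"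
      using g(1) witt_e_carrier unfolding lie_linear_def by blast
    finally show ?thesis by (simp add: virasoro_value_def)
  qed
  obtain \<epsilon> where \<epsilon>: "dot \<mu> \<epsilon> \<noteq> 0" using generic_exponent[OF \<mu>] by blast
  define p G where "p = dot \<mu> \<epsilon>" and "G = g (witt_e \<mu> 0)"
  have "p ^ 3 - p = 12 * (- 2 * p * G)"
    unfolding p_def G_def at_0[symmetric] by simp
  moreover have "(p + p) ^ 3 - (p + p) = 12 * (- 2 * (p + p) * G)"
    unfolding p_def G_def dot_simps(1)[symmetric] at_0[symmetric] by simp
  ultimately have "6 * p ^ 3 = 0" by algebra
  then show False using \<epsilon> by (simp add: p_def)
qed


section \<open>The universal central extension\<close>

lemma vir_sel [simp]:
  "lie_carrier (vir \<mu>) = range (vfield \<mu>) \<times> UNIV"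
  "lie_scale (vir \<mu>) c u = (lie_scale (witt \<mu>) c (fst u), c * snd u)"
  "lie_bracket (vir \<mu>) u v = (lie_bracket (witt \<mu>) (fst u) (fst v), C_mu \<mu> (fst u) (fst v))"
  by (simp_all add: vir_def)

lemma vir_central_extension: "generic \<mu> \<Longrightarrow> central_extension (witt \<mu>) (vir \<mu>) fst"
  unfolding vir_def by (intro central_extension_cocycle_extension lie_algebra_witt two_cocycle_C_mu)

lemma lie_algebra_vir: "generic \<mu> \<Longrightarrow> lie_algebra (vir \<mu>)"
  using vir_central_extension by (auto simp: central_extension_def)

lemma vir_basis_bracket:
  assumes "generic \<mu>"
  shows "lie_bracket (vir \<mu>) (vir_e \<mu> \<alpha>) (vir_e \<mu> \<beta>) =
    lie_scale (vir \<mu>) (dot \<mu> \<beta> - dot \<mu> \<alpha>) (vir_e \<mu> (\<alpha> + \<beta>)) +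
    lie_scale (vir \<mu>) (virasoro_value \<mu> \<alpha> \<beta>) vir_c"
proof -
  interpret L: lie_algebra "witt \<mu>" by (rule lie_algebra_witt)
  show ?thesis by (simp add: vir_e_def vir_c_def witt_basis_bracket C_mu_basis[OF assms] del: witt_sel)
qed

lemma vir_span:
  assumes \<mu>: "generic \<mu>"
  shows "module.span (lie_scale (vir \<mu>)) (range (vir_e \<mu>) \<union> {vir_c}) = lie_carrier (vir \<mu>)"
proof -
  interpret V: lie_algebra "vir \<mu>" by (rule lie_algebra_vir[OF \<mu>])
  interpret W: lie_algebra "witt \<mu>" by (rule lie_algebra_witt)
  let ?S = "V.span (range (vir_e \<mu>) \<union> {vir_c})"
  have c: "(0, z) \<in> ?S" for z
  proof -
    have "lie_scale (vir \<mu>) z vir_c \<in> ?S" by (intro V.span_scale V.span_base) simp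
    then show ?thesis by (simp add: vir_c_def)
  qed
  have "(vfield \<mu> a, 0) \<in> ?S" for a
  proof (induction a rule: update_induct)
    case const
    then show ?case using c[of 0] by (simp only: vfield_0)
  next
    case (update f \<alpha> x)
    have "lie_scale (vir \<mu>) x (vir_e \<mu> \<alpha>) \<in> ?S" by (intro V.span_scale V.span_base) simp
    then have "(vfield \<mu> (Poly_Mapping.single \<alpha> x), 0) \<in> ?S"
      by (simp add: vir_e_def witt_e_def laurent_monom_def)
    from V.span_add[OF update(3) this] show ?case
      by (simp add: update_eq_add_single[OF update(1)] vfield_add del: vir_sel)
  qed
  from V.span_add[OF this c] have "lie_carrier (vir \<mu>) \<subseteq> ?S" by auto
  moreover have "?S \<subseteq> lie_carrier (vir \<mu>)"
    by (intro V.span_minimal V.subspace_carrier) (auto simp: vir_e_def vir_c_def witt_e_def)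
  ultimately show ?thesis by blast
qed

text \<open>No basis element lies in the span of the others, since a coordinate that is nonzero on it vanishes
  on them.\<close>

lemma vir_independent:
  assumes \<mu>: "generic \<mu>"
  shows "\<not> module.dependent (lie_scale (vir \<mu>)) (range (vir_e \<mu>) \<union> {vir_c})"
proof
  interpret V: lie_algebra "vir \<mu>" by (rule lie_algebra_vir[OF \<mu>])
  let ?B = "range (vir_e \<mu>) \<union> {vir_c}"
  define A where "A P = {(vfield \<mu> a, z) | a z. P a z}" for P :: "'a laurent \<Rightarrow> complex \<Rightarrow> bool"
  have mem: "(vfield \<mu> a, z) \<in> A P \<longleftrightarrow> P a z" for a z P
    using inj_vfield[OF \<mu>] by (auto simp: A_def inj_eq)
  have sub: "V.subspace (A P)" if "P 0 0" "\<And>a b z w. P a z \<Longrightarrow> P b w \<Longrightarrow> P (a + b) (z + w)"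
      "\<And>a z c. P a z \<Longrightarrow> P (laurent_scale c a) (c * z)" for P
    unfolding V.subspace_def using that mem[of 0 0 P]
    by (auto simp: vfield_0 zero_prod_def) (auto simp: A_def vfield_add; blast)+
  assume "V.dependent ?B"
  then obtain b where b: "b \<in> ?B" "b \<in> V.span (?B - {b})" unfolding V.dependent_def by blast
  have e: "vir_e \<mu> \<alpha> = (vfield \<mu> (Poly_Mapping.single \<alpha> 1), 0)" for \<alpha>
    by (simp add: vir_e_def witt_e_def laurent_monom_def)
  have c: "vir_c = (vfield \<mu> 0, 1)" by (simp add: vir_c_def vfield_0)
  consider \<alpha> where "b = vir_e \<mu> \<alpha>" | "b = vir_c" using b(1) by blast
  then show False
  proof cases
    case 1
    let ?P = "\<lambda>a z. Poly_Mapping.lookup a \<alpha> = 0"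
    have "?B - {b} \<subseteq> A ?P"
      using 1 by (auto simp: e c mem lookup_single when_def split: if_splits)
    then have "b \<in> A ?P"
      using V.span_minimal[OF _ sub[of ?P]] b(2) by (auto simp: lookup_add)
    then show False by (simp add: 1 e mem)
  next
    case 2
    let ?P = "\<lambda>a z. z = 0"
    have "?B - {b} \<subseteq> A ?P"
      using 2 by (auto simp: e mem)
    then have "b \<in> A ?P"
      using V.span_minimal[OF _ sub[of ?P]] b(2) by auto
    then show False by (simp add: 2 c mem)
  qed
qed

text \<open>Bracketing with \<open>e\<^sub>0\<close> yields the basis elements of nonzero degree. Both \<open>[e\<^sub>\<epsilon>, e\<^sub>-\<^sub>\<epsilon>]\<close> and the same bracket
  for \<open>2\<epsilon>\<close> are combinations of \<open>e\<^sub>0\<close> and \<open>c\<close>. The cubic term makes these combinations independent, so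
  they yield \<open>e\<^sub>0\<close> and \<open>c\<close>.\<close>

lemma vir_perfect:
  assumes \<mu>: "generic \<mu>"
  shows "lie_carrier (vir \<mu>) \<subseteq> module.span (lie_scale (vir \<mu>))
    {lie_bracket (vir \<mu>) x y |x y. x \<in> lie_carrier (vir \<mu>) \<and> y \<in> lie_carrier (vir \<mu>)}"
    (is "_ \<subseteq> module.span _ ?B")
proof -
  interpret V: lie_algebra "vir \<mu>" by (rule lie_algebra_vir[OF \<mu>])
  let ?S = "V.span ?B"
  let ?s = "lie_scale (vir \<mu>)"
  have br: "?s (dot \<mu> \<beta> - dot \<mu> \<alpha>) (vir_e \<mu> (\<alpha> + \<beta>)) + ?s (virasoro_value \<mu> \<alpha> \<beta>) vir_c \<in> ?S" for \<alpha> \<beta>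
  proof -
    have "lie_bracket (vir \<mu>) (vir_e \<mu> \<alpha>) (vir_e \<mu> \<beta>) \<in> ?B"
      by (intro CollectI exI conjI refl) (auto simp: vir_e_def witt_e_def)
    then have "lie_bracket (vir \<mu>) (vir_e \<mu> \<alpha>) (vir_e \<mu> \<beta>) \<in> ?S" by (rule V.span_base)
    then show ?thesis unfolding vir_basis_bracket[OF \<mu>] .
  qed
  have cancel: "x \<in> ?S" if "?s z x \<in> ?S" "z \<noteq> 0" for x z
  proof -
    have "?s (1 / z) (?s z x) \<in> ?S" using that(1) by (rule V.span_scale)
    then show ?thesis unfolding V.scale_scale using that(2) by (simp del: vir_sel)
  qed
  obtain \<epsilon> where \<epsilon>: "dot \<mu> \<epsilon> \<noteq> 0" using generic_exponent[OF \<mu>] by blast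
  define p where "p = dot \<mu> \<epsilon>"
  have one: "?s (- 2 * p) (vir_e \<mu> 0) + ?s ((p ^ 3 - p) / 12) vir_c \<in> ?S"
    using br[where \<alpha> = \<epsilon> and \<beta> = "- \<epsilon>"] by (simp add: p_def virasoro_value_def del: vir_sel)
  have two: "?s (- 4 * p) (vir_e \<mu> 0) + ?s ((8 * p ^ 3 - 2 * p) / 12) vir_c \<in> ?S"
  proof -
    have "- (p + p) - (p + p) = - 4 * p" "(p + p) ^ 3 - (p + p) = 8 * p ^ 3 - 2 * p" by algebra+
    then show ?thesis
      using br[where \<alpha> = "\<epsilon> + \<epsilon>" and \<beta> = "- (\<epsilon> + \<epsilon>)"]
      by (simp only: virasoro_value_def dot_simps p_def[symmetric] minus_minus right_minus simp_thms if_True)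
  qed
  have "2 * (- 2 * p) = - 4 * p" by simp
  then have "?s 2 (?s (- 2 * p) (vir_e \<mu> 0) + ?s ((p ^ 3 - p) / 12) vir_c) =
      ?s (- 4 * p) (vir_e \<mu> 0) + ?s (2 * ((p ^ 3 - p) / 12)) vir_c"
    by (simp only: V.scale_right_distrib V.scale_scale)
  with V.span_diff[OF two V.span_scale[OF one, of 2]]
  have "?s ((8 * p ^ 3 - 2 * p) / 12) vir_c - ?s (2 * ((p ^ 3 - p) / 12)) vir_c \<in> ?S"
    by (simp del: vir_sel)
  moreover have "(8 * p ^ 3 - 2 * p) / 12 - 2 * ((p ^ 3 - p) / 12) = p ^ 3 / 2"
    by (simp add: field_simps)
  ultimately have "?s (p ^ 3 / 2) vir_c \<in> ?S"
    by (simp only: V.scale_left_diff_distrib[symmetric])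
  then have c: "vir_c \<in> ?S" by (rule cancel) (use \<epsilon> in \<open>simp add: p_def\<close>)
  have "?s (- 2 * p) (vir_e \<mu> 0) \<in> ?S"
    using V.span_diff[OF one V.span_scale[OF c, of "(p ^ 3 - p) / 12"]]
    by (simp only: add_diff_cancel_right')
  then have e0: "vir_e \<mu> 0 \<in> ?S" by (rule cancel) (use \<epsilon> in \<open>simp add: p_def\<close>)
  have e_nz: "vir_e \<mu> \<gamma> \<in> ?S" if "\<gamma> \<noteq> 0" for \<gamma>
    using br[where \<alpha> = 0 and \<beta> = \<gamma>] that cancel[of "dot \<mu> \<gamma>" "vir_e \<mu> \<gamma>"] \<mu>
    by (auto simp: virasoro_value_def generic_def simp del: vir_sel)
  have "vir_e \<mu> \<gamma> \<in> ?S" for \<gamma>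
    by (cases "\<gamma> = 0") (simp only: e0, rule e_nz)
  with c have "range (vir_e \<mu>) \<union> {vir_c} \<subseteq> ?S" by (simp add: image_subset_iff del: vir_sel)
  then show ?thesis
    unfolding vir_span[OF \<mu>, symmetric] by (intro V.span_minimal V.subspace_span)
qed

text \<open>Arbitrary lifts \<open>f \<alpha>\<close> of the basis satisfy the bracket relations up to central elements \<open>\<psi> \<alpha> \<beta>\<close>,
  and the Jacobi identity makes \<open>\<psi>\<close> a cocycle. Adding to \<open>f\<close> the function \<open>g\<close> of its normal form
  removes the coboundary part without changing any bracket; the coefficient \<open>k\<close> of what remains is
  where the central element \<open>c\<close> has to go.\<close>

lemma witt_basis_lift:
  assumes \<mu>: "generic (\<mu> :: complex ^ 'n::finite)" and ext: "central_extension (witt \<mu>) F q"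
  obtains h k where "\<And>\<alpha>. h \<alpha> \<in> lie_carrier F" "\<And>\<alpha>. q (h \<alpha>) = witt_e \<mu> \<alpha>"
    "k \<in> lie_kernel F q"
    "\<And>\<alpha> \<beta>. lie_bracket F (h \<alpha>) (h \<beta>) =
      lie_scale F (dot \<mu> \<beta> - dot \<mu> \<alpha>) (h (\<alpha> + \<beta>)) + lie_scale F (virasoro_value \<mu> \<alpha> \<beta>) k"
proof -
  interpret L: lie_algebra "witt \<mu>" by (rule lie_algebra_witt)
  interpret F: lie_algebra F using ext by (simp add: central_extension_def)
  have q: "lie_hom F (witt \<mu>) q" and surj: "q ` lie_carrier F = lie_carrier (witt \<mu>)"
    and central: "lie_kernel F q \<subseteq> lie_center F"
    using ext by (auto simp: central_extension_def)
  note q_simps = lie_hom_add_scale[OF q]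
  note kernel = lie_kernel_diff[OF F.lie_algebra_axioms L.lie_algebra_axioms q]
  have sub: "F.subspace (lie_kernel F q)"
    using subspace_lie_kernel[OF F.lie_algebra_axioms L.lie_algebra_axioms q] .
  have "\<exists>x. x \<in> lie_carrier F \<and> q x = witt_e \<mu> \<alpha>" for \<alpha>
    using witt_e_carrier[of \<mu> \<alpha>] surj by (metis imageE)
  then obtain f where f: "f \<alpha> \<in> lie_carrier F" "q (f \<alpha>) = witt_e \<mu> \<alpha>" for \<alpha>
    by metis
  define \<psi> where "\<psi> \<alpha> \<beta> = lie_bracket F (f \<alpha>) (f \<beta>) - lie_scale F (dot \<mu> \<beta> - dot \<mu> \<alpha>) (f (\<alpha> + \<beta>))" for \<alpha> \<beta>
  have sc: "lie_scale F c (f \<alpha>) \<in> lie_carrier F" for c \<alpha>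
    by (intro F.subspace_scale F.subspace_carrier f)
  have \<psi>_mem: "\<psi> \<alpha> \<beta> \<in> lie_kernel F q" for \<alpha> \<beta>
    unfolding \<psi>_def
    by (subst kernel) (simp_all add: F.bracket_closed f sc q_simps witt_basis_bracket del: witt_sel)
  have central_mem: "z \<in> lie_center F" "z \<in> lie_carrier F" if "z \<in> lie_kernel F q" for z
    using that central by (auto simp: lie_kernel_def)
  have bracket: "lie_bracket F (f \<alpha>) (f \<beta>) = \<psi> \<alpha> \<beta> + lie_scale F (dot \<mu> \<beta> - dot \<mu> \<alpha>) (f (\<alpha> + \<beta>))" for \<alpha> \<beta>
    by (simp add: \<psi>_def)
  have double: "lie_bracket F (f \<alpha>) (lie_bracket F (f \<beta>) (f \<gamma>)) =
      lie_scale F (dot \<mu> \<gamma> - dot \<mu> \<beta>) (\<psi> \<alpha> (\<beta> + \<gamma>)) +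
      lie_scale F ((dot \<mu> \<gamma> - dot \<mu> \<beta>) * (dot \<mu> \<beta> + dot \<mu> \<gamma> - dot \<mu> \<alpha>)) (f (\<alpha> + \<beta> + \<gamma>))" for \<alpha> \<beta> \<gamma>
  proof -
    have "lie_bracket F (f \<alpha>) (lie_bracket F (f \<beta>) (f \<gamma>)) =
        lie_scale F (dot \<mu> \<gamma> - dot \<mu> \<beta>) (lie_bracket F (f \<alpha>) (f (\<beta> + \<gamma>)))"
      unfolding bracket[of \<beta> \<gamma>]
      using central_mem[OF \<psi>_mem[of \<beta> \<gamma>]]
      by (simp add: F.bracket_add_right F.bracket_center F.bracket_scale_right f sc)
    then show ?thesis
      unfolding bracket[of \<alpha> "\<beta> + \<gamma>"] by (simp only: F.scale_right_distrib F.scale_scale dot_simps add.assoc)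
  qed
  interpret graded_cocycle "lie_scale F" "dot \<mu>" \<psi>
  proof
    fix \<alpha> \<beta> \<gamma>
    show "dot \<mu> \<alpha> = 0 \<Longrightarrow> \<alpha> = 0" using \<mu> by (auto simp: generic_def)
    show "\<psi> \<alpha> \<beta> = - \<psi> \<beta> \<alpha>"
      using F.bracket_antisym[OF f(1) f(1), of \<alpha> \<beta>]
      by (simp add: \<psi>_def add.commute F.scale_left_diff_distrib)
    define x y z where "x = dot \<mu> \<alpha>" and "y = dot \<mu> \<beta>" and "z = dot \<mu> \<gamma>"
    define v where "v = f (\<alpha> + \<beta> + \<gamma>)"
    have "\<beta> + \<gamma> + \<alpha> = \<alpha> + \<beta> + \<gamma>" "\<gamma> + \<alpha> + \<beta> = \<alpha> + \<beta> + \<gamma>" by (simp_all add: ac_simps)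
    then have "(lie_scale F (z - y) (\<psi> \<alpha> (\<beta> + \<gamma>)) + lie_scale F ((z - y) * (y + z - x)) v) +
        (lie_scale F (x - z) (\<psi> \<beta> (\<gamma> + \<alpha>)) + lie_scale F ((x - z) * (z + x - y)) v) +
        (lie_scale F (y - x) (\<psi> \<gamma> (\<alpha> + \<beta>)) + lie_scale F ((y - x) * (x + y - z)) v) = 0"
      using F.jacobi[OF f(1) f(1) f(1), of \<alpha> \<beta> \<gamma>] by (simp only: double x_def y_def z_def v_def)
    \<comment> \<open>The terms in the direction of \<open>v\<close> cancel by the Jacobi identity of the Witt algebra itself.\<close>
    moreover have "lie_scale F ((z - y) * (y + z - x)) v + lie_scale F ((x - z) * (z + x - y)) v +
        lie_scale F ((y - x) * (x + y - z)) v = 0"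
    proof -
      have "(z - y) * (y + z - x) + (x - z) * (z + x - y) + (y - x) * (x + y - z) = 0" by algebra
      then show ?thesis unfolding F.scale_left_distrib[symmetric] by simp
    qed
    ultimately show "lie_scale F (dot \<mu> \<gamma> - dot \<mu> \<beta>) (\<psi> \<alpha> (\<beta> + \<gamma>)) +
        lie_scale F (dot \<mu> \<alpha> - dot \<mu> \<gamma>) (\<psi> \<beta> (\<gamma> + \<alpha>)) +
        lie_scale F (dot \<mu> \<beta> - dot \<mu> \<alpha>) (\<psi> \<gamma> (\<alpha> + \<beta>)) = 0"
      unfolding x_def[symmetric] y_def[symmetric] z_def[symmetric]
      by (metis (no_types, lifting) add.assoc add.commute add_0)
  qed simp
  obtain \<epsilon> :: "int ^ 'n" where "\<epsilon> \<noteq> 0" using generic_exponent[OF \<mu>] by blast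
  from normal_form[OF sub \<psi>_mem this]
  obtain g k where "k \<in> lie_kernel F q \<and> (\<forall>\<alpha>. g \<alpha> \<in> lie_kernel F q) \<and>
    (\<forall>\<alpha> \<beta>. \<psi> \<alpha> \<beta> = lie_scale F (dot \<mu> \<beta> - dot \<mu> \<alpha>) (g (\<alpha> + \<beta>)) +
      lie_scale F (virasoro_value \<mu> \<alpha> \<beta>) k)"
    unfolding virasoro_value_def by (elim exE)
  then have gk: "k \<in> lie_kernel F q" "\<And>\<alpha>. g \<alpha> \<in> lie_kernel F q"
    "\<And>\<alpha> \<beta>. \<psi> \<alpha> \<beta> = lie_scale F (dot \<mu> \<beta> - dot \<mu> \<alpha>) (g (\<alpha> + \<beta>)) +
      lie_scale F (virasoro_value \<mu> \<alpha> \<beta>) k"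
    by blast+
  define h where "h \<alpha> = f \<alpha> + g \<alpha>" for \<alpha>
  show ?thesis
  proof
    show "k \<in> lie_kernel F q" by fact
    fix \<alpha> \<beta>
    show "h \<alpha> \<in> lie_carrier F" unfolding h_def
      by (intro F.subspace_add F.subspace_carrier f central_mem gk)
    show "q (h \<alpha>) = witt_e \<mu> \<alpha>"
      using gk(2)[of \<alpha>] by (simp add: h_def q_simps f lie_kernel_def)
    show "lie_bracket F (h \<alpha>) (h \<beta>) =
      lie_scale F (dot \<mu> \<beta> - dot \<mu> \<alpha>) (h (\<alpha> + \<beta>)) + lie_scale F (virasoro_value \<mu> \<alpha> \<beta>) k"
      unfolding h_def F.bracket_add_central[OF f(1) f(1) central_mem(1)[OF gk(2)] central_mem(1)[OF gk(2)]]
        bracket gk(3) F.scale_right_distrib by (simp add: ac_simps)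
  qed
qed

text \<open>The lift is forced: it is linear, and the basis elements of the Witt algebra go to the corrected
  lifts \<open>h \<alpha>\<close> and \<open>c\<close> to the central element \<open>k\<close>. By bilinearity, compatibility with brackets is
  the relation between the \<open>h \<alpha>\<close> and \<open>k\<close>.\<close>

lemma vir_lift_exists:
  assumes \<mu>: "generic \<mu>" and ext: "central_extension (witt \<mu>) F q"
  obtains f where "lie_hom (vir \<mu>) F f" "\<And>x. x \<in> lie_carrier (vir \<mu>) \<Longrightarrow> q (f x) = fst x"
proof -
  interpret L: lie_algebra "witt \<mu>" by (rule lie_algebra_witt)
  interpret F: lie_algebra F using ext by (simp add: central_extension_def)
  have q: "lie_hom F (witt \<mu>) q" and central: "lie_kernel F q \<subseteq> lie_center F"
    using ext by (auto simp: central_extension_def)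
  note q_simps = lie_hom_add_scale[OF q]
  obtain h k where h: "\<And>\<alpha>. h \<alpha> \<in> lie_carrier F" "\<And>\<alpha>. q (h \<alpha>) = witt_e \<mu> \<alpha>"
    and k: "k \<in> lie_kernel F q"
    and bracket: "\<And>\<alpha> \<beta>. lie_bracket F (h \<alpha>) (h \<beta>) =
      lie_scale F (dot \<mu> \<beta> - dot \<mu> \<alpha>) (h (\<alpha> + \<beta>)) + lie_scale F (virasoro_value \<mu> \<alpha> \<beta>) k"
    using witt_basis_lift[OF \<mu> ext] by blast
  have kz: "lie_scale F z k \<in> lie_kernel F q" for z
    using F.subspace_scale[OF subspace_lie_kernel[OF F.lie_algebra_axioms L.lie_algebra_axioms q] k] .
  have kz_carrier: "lie_scale F z k \<in> lie_carrier F" "q (lie_scale F z k) = 0"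
    and kz_center: "lie_scale F z k \<in> lie_center F" for z
    using kz[of z] central by (auto simp: lie_kernel_def)
  let ?l = "linear_extension (lie_scale F) h"
  have l: "?l a \<in> lie_carrier F" for a
    by (intro F.linear_extension_in F.subspace_carrier h)
  have ql: "q (?l a) = vfield \<mu> a" for a
    by (rule additive_on_monomials_eqI[where F = "\<lambda>a. q (?l a)"])
      (simp_all add: F.linear_extension_add q_simps(1,2) l h vfield_add witt_e_def laurent_monom_def)
  have bl: "lie_bracket F (?l a) (?l b) =
      ?l (witt_coeff_bracket \<mu> a b) + lie_scale F (coeff_cocycle \<mu> a b) k" for a b
  proof (rule additive_on_monomials_eqI[where F = "\<lambda>a. lie_bracket F (?l a) (?l b)"])
    fix \<alpha> x
    show "lie_bracket F (?l (Poly_Mapping.single \<alpha> x)) (?l b) =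
        ?l (witt_coeff_bracket \<mu> (Poly_Mapping.single \<alpha> x) b) +
        lie_scale F (coeff_cocycle \<mu> (Poly_Mapping.single \<alpha> x) b) k"
    proof (rule additive_on_monomials_eqI[where F = "\<lambda>b. lie_bracket F _ (?l b)"])
      fix \<beta> y
      have "lie_bracket F (lie_scale F x (h \<alpha>)) (lie_scale F y (h \<beta>)) =
          lie_scale F x (lie_scale F y (lie_bracket F (h \<alpha>) (h \<beta>)))"
        by (simp only: F.bracket_scale_left F.bracket_scale_right h F.subspace_scale[OF F.subspace_carrier])
          (rule F.scale_left_commute)
      also have "\<dots> = lie_scale F (x * y * (dot \<mu> \<beta> - dot \<mu> \<alpha>)) (h (\<alpha> + \<beta>)) +
          lie_scale F (x * y * virasoro_value \<mu> \<alpha> \<beta>) k"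
        by (simp only: bracket F.scale_right_distrib F.scale_scale mult.assoc)
      finally show "lie_bracket F (?l (Poly_Mapping.single \<alpha> x)) (?l (Poly_Mapping.single \<beta> y)) =
          ?l (witt_coeff_bracket \<mu> (Poly_Mapping.single \<alpha> x) (Poly_Mapping.single \<beta> y)) +
          lie_scale F (coeff_cocycle \<mu> (Poly_Mapping.single \<alpha> x) (Poly_Mapping.single \<beta> y)) k"
        by (simp only: F.linear_extension_single witt_coeff_bracket_simps coeff_cocycle_simps)
    qed (simp_all add: F.linear_extension_add F.bracket_add_right l h F.subspace_scale[OF F.subspace_carrier]
        witt_coeff_bracket_simps coeff_cocycle_simps F.scale_left_distrib)
  qed (simp_all add: F.linear_extension_add F.bracket_add_left l
        witt_coeff_bracket_simps coeff_cocycle_simps F.scale_left_distrib)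
  define f where "f u = ?l (witt_coeff \<mu> (fst u)) + lie_scale F (snd u) k" for u
  have f: "f (vfield \<mu> a, z) = ?l a + lie_scale F z k" for a z
    by (simp add: f_def \<mu>)
  show ?thesis
  proof
    show "lie_hom (vir \<mu>) F f"
      unfolding lie_hom_def lie_linear_def
      by (auto simp: f vfield_add F.linear_extension_add F.scale_left_distrib F.scale_right_distrib
          linear_extension_laurent_scale[OF F.vector_space_axioms] bl C_mu_vfield[OF \<mu>]
          F.bracket_add_central[OF l l kz_center kz_center]
          intro!: F.subspace_add[OF F.subspace_carrier] l kz_carrier)
    show "q (f x) = fst x" if "x \<in> lie_carrier (vir \<mu>)" for x
      using that by (auto simp: f q_simps l kz_carrier ql)
  qed
qed

lemma vir_universal:
  assumes \<mu>: "generic \<mu>"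
  shows "universal_central_extension TYPE('e::ab_group_add) (witt \<mu>) (vir \<mu>) fst"
  unfolding universal_central_extension_def
proof (intro conjI allI impI)
  show "central_extension (witt \<mu>) (vir \<mu>) fst" by (rule vir_central_extension[OF \<mu>])
  fix F :: "'e cx_lie" and q
  assume ext: "central_extension (witt \<mu>) F q"
  then obtain f where f: "lie_hom (vir \<mu>) F f" "\<And>x. x \<in> lie_carrier (vir \<mu>) \<Longrightarrow> q (f x) = fst x"
    using vir_lift_exists[OF \<mu> ext] by blast
  have "\<forall>x\<in>lie_carrier (vir \<mu>). g x = f x"
    if "lie_hom (vir \<mu>) F g" "\<forall>x\<in>lie_carrier (vir \<mu>). q (g x) = fst x" for g
    using lifts_unique[OF lie_algebra_vir[OF \<mu>] ext vir_perfect[OF \<mu>] f(1) that(1)] f(2) that(2)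
    by (metis)
  with f show "\<exists>f. lie_hom (vir \<mu>) F f \<and> (\<forall>x\<in>lie_carrier (vir \<mu>). q (f x) = fst x) \<and>
      (\<forall>g. lie_hom (vir \<mu>) F g \<and> (\<forall>x\<in>lie_carrier (vir \<mu>). q (g x) = fst x) \<longrightarrow>
        (\<forall>x\<in>lie_carrier (vir \<mu>). g x = f x))"
    by blast
qed

lemma vir_kernel: "lie_kernel (vir \<mu>) fst = range (\<lambda>a. lie_scale (vir \<mu>) a vir_c)"
proof -
  interpret L: lie_algebra "witt \<mu>" by (rule lie_algebra_witt)
  show ?thesis by (auto simp: lie_kernel_def vir_c_def)
qed

lemma vir_kernel_dim:
  assumes \<mu>: "generic \<mu>"
  shows "vector_space.dim (lie_scale (vir \<mu>)) (lie_kernel (vir \<mu>) fst) = 1"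
proof -
  interpret V: lie_algebra "vir \<mu>" by (rule lie_algebra_vir[OF \<mu>])
  have "V.span {vir_c} = lie_kernel (vir \<mu>) fst"
    unfolding vir_kernel V.span_singleton ..
  moreover have "V.independent {vir_c}"
    using vir_independent[OF \<mu>] V.independent_mono by blast
  ultimately show ?thesis using V.dim_span_eq_card_independent[of "{vir_c}"] by simp
qed

lemma inj_vir_e: "generic \<mu> \<Longrightarrow> inj (vir_e \<mu>)"
  using inj_vfield[of \<mu>]
  by (auto simp: inj_def vir_e_def witt_e_def laurent_monom_def) 
     (metis lookup_single_eq lookup_single_not_eq zero_neq_one)

lemma bracket_vir_c:
  assumes "generic \<mu>" "x \<in> lie_carrier (vir \<mu>)"
  shows "lie_bracket (vir \<mu>) x vir_c = 0"
proof -
  interpret V: lie_algebra "vir \<mu>" by (rule lie_algebra_vir[OF assms(1)])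
  have "vir_c \<in> lie_kernel (vir \<mu>) fst" by (simp add: lie_kernel_def vir_c_def)
  then have "vir_c \<in> lie_center (vir \<mu>)"
    using vir_central_extension[OF assms(1)] by (auto simp only: central_extension_def)
  from V.bracket_center(1)[OF this assms(2)] show ?thesis .
qed

theorem theorem2p1:
  fixes \<mu> :: "complex ^ 'n::finite"
  assumes "generic \<mu>"
  shows
    "universal_central_extension TYPE('e::ab_group_add) (witt \<mu>) (vir \<mu>) fst \<and>
     vector_space.dim (lie_scale (vir \<mu>)) (lie_kernel (vir \<mu>) fst) = 1 \<and>
     lie_kernel (vir \<mu>) fst = range (\<lambda>a. lie_scale (vir \<mu>) a vir_c) \<and>
     two_cocycle (witt \<mu>) (C_mu \<mu>) \<and>
     (\<forall>\<alpha> \<beta>. C_mu \<mu> (witt_e \<mu> \<alpha>) (witt_e \<mu> \<beta>) =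
        (dot \<mu> \<alpha> ^ 3 - dot \<mu> \<alpha>) / 12 * (if \<alpha> = - \<beta> then 1 else 0)) \<and>
     \<not> two_coboundary (witt \<mu>) (C_mu \<mu>) \<and>
     (\<forall>\<psi>. two_cocycle (witt \<mu>) \<psi> \<longrightarrow>
        (\<exists>a. two_coboundary (witt \<mu>) (\<lambda>x y. \<psi> x y - a * C_mu \<mu> x y))) \<and>
     inj (vir_e \<mu>) \<and> vir_c \<notin> range (vir_e \<mu>) \<and>
     \<not> module.dependent (lie_scale (vir \<mu>)) (range (vir_e \<mu>) \<union> {vir_c}) \<and>
     module.span (lie_scale (vir \<mu>)) (range (vir_e \<mu>) \<union> {vir_c}) = lie_carrier (vir \<mu>) \<and>
     (\<forall>\<alpha> \<beta>. lie_bracket (vir \<mu>) (vir_e \<mu> \<alpha>) (vir_e \<mu> \<beta>) =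
        lie_scale (vir \<mu>) (dot \<mu> (\<beta> - \<alpha>)) (vir_e \<mu> (\<alpha> + \<beta>)) +
        lie_scale (vir \<mu>) ((dot \<mu> \<alpha> ^ 3 - dot \<mu> \<alpha>) / 12 * (if \<alpha> = - \<beta> then 1 else 0)) vir_c) \<and>
     (\<forall>x\<in>lie_carrier (vir \<mu>). lie_bracket (vir \<mu>) x vir_c = 0)"
proof -
  have v: "virasoro_value \<mu> \<alpha> \<beta> = (dot \<mu> \<alpha> ^ 3 - dot \<mu> \<alpha>) / 12 * (if \<alpha> = - \<beta> then 1 else 0)" for \<alpha> \<beta>
    by (simp add: virasoro_value_def)
  have "vir_c \<notin> range (vir_e \<mu>)" by (auto simp: vir_e_def vir_c_def)
  then show ?thesis
    using vir_universal[OF assms] vir_kernel_dim[OF assms] vir_kernel[of \<mu>] two_cocycle_C_mu[OF assms]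
      C_mu_basis[OF assms] C_mu_not_coboundary[OF assms] witt_cocycle_decomposition[OF assms]
      inj_vir_e[OF assms] vir_independent[OF assms] vir_span[OF assms] vir_basis_bracket[OF assms]
      bracket_vir_c[OF assms]
    unfolding v dot_simps by blast
qed

end
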